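(* For a partial solution $(A,w)$ and threshold $t\ge0$, there is an algorithm running in time $O(|E|)$ that returns a pair $(c_t,p_t)$ with $c_t\in C\setminus A$ and $p_t=\mathrm{prescore}_{(A,w)}(c_t,t)=\max_{c'\in C\setminus A}\mathrm{prescore}_{(A,w)}(c',t)$. Furthermore, there is an algorithm running in time $O(|E|\cdot\log k)$ that, given a partial solution $(A,w)$, returns a pair $(c_{\max},t_{\max})$ with $c_{\max}\in C\setminus A$ and $t_{\max}=\mathrm{score}_{(A,w)}(c_{\max})=\max_{c'\in C\setminus A}\mathrm{score}_{(A,w)}(c')$.
   Context: An election instance consists of a finite bipartite graph $G=(N\cup C,E)$ with no isolated vertices ($N$ = voters, $C$ = candidates), a vector $s\in\mathbb{R}^N$ of non-negative vote strengths, and an integer $k$ with $0<k<|C|$. Write $nc$ for $\{n,c\}$, $C_n=\{c: nc\in E\}$, $N_c=\{n: nc\in E\}$. A weight vector $w\in\mathbb{R}^E$ is feasible if $w\ge0$ and $\sum_{c\in C_n}w_{nc}\le s_n$ for all $n$. $\mathrm{supp}_w(c)=\sum_{n\in N_c}w_{nc}$. A partial solution is $(A,w)$ with $A\subseteq C$, $|A|\le k$, $w$ feasible; the supports $(\mathrm{supp}_w(c))_{c\in A}$ are assumed available. For $n\in N$, $t\ge0$: $\mathrm{slack}(n,t)=s_n-\sum_{c\in A\cap C_n}w_{nc}\min\{1,t/\mathrm{supp}_w(c)\}$; for $c'\in C\setminus A$, $\mathrm{prescore}_{(A,w)}(c',t)=\sum_{n\in N_{c'}}\mathrm{slack}(n,t)$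 and $\mathrm{score}_{(A,w)}(c')=\max\{t\ge0:\mathrm{prescore}_{(A,w)}(c',t)\ge t\}$. Numerical operations take constant time. *)

theory Defs
  imports Complex_Main
begin

section \<open>Elections and partial solutions\<close>

text \<open>
  The two sides of the bipartite graph live in different types and hence are disjoint; the edge
  \<open>nc\<close> is the pair \<open>(n, c)\<close>. Only the values of a weight vector on edges are relevant.
\<close>

record ('n, 'c) election =
  voters :: "'n set"
  cands :: "'c set"
  edges :: "('n \<times> 'c) set"
  strength :: "'n \<Rightarrow> real"
  seats :: nat

definition election_instance :: "('n, 'c) election \<Rightarrow> bool" where
  "election_instance I \<longleftrightarrow>
     finite (voters I) \<and> finite (cands I) \<and> edges I \<subseteq> voters I \<times> cands I \<and>
     (\<forall>n\<in>voters I. \<exists>c. (n, c) \<in> edges I) \<and> (\<forall>c\<in>cands I. \<exists>n. (n, c) \<in> edges I) \<and>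
     (\<forall>n\<in>voters I. 0 \<le> strength I n) \<and>
     0 < seats I \<and> seats I < card (cands I)"

definition cands_of :: "('n, 'c) election \<Rightarrow> 'n \<Rightarrow> 'c set" where
  "cands_of I n = {c. (n, c) \<in> edges I}"

definition voters_of :: "('n, 'c) election \<Rightarrow> 'c \<Rightarrow> 'n set" where
  "voters_of I c = {n. (n, c) \<in> edges I}"

definition feasible :: "('n, 'c) election \<Rightarrow> ('n \<times> 'c \<Rightarrow> real) \<Rightarrow> bool" where
  "feasible I w \<longleftrightarrow>
     (\<forall>e\<in>edges I. 0 \<le> w e) \<and> (\<forall>n\<in>voters I. (\<Sum>c\<in>cands_of I n. w (n, c)) \<le> strength I n)"

definition supp :: "('n, 'c) election \<Rightarrow> ('n \<times> 'c \<Rightarrow> real) \<Rightarrow> 'c \<Rightarrow> real" where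
  "supp I w c = (\<Sum>n\<in>voters_of I c. w (n, c))"

definition partial_solution ::
  "('n, 'c) election \<Rightarrow> 'c set \<Rightarrow> ('n \<times> 'c \<Rightarrow> real) \<Rightarrow> bool" where
  "partial_solution I A w \<longleftrightarrow> A \<subseteq> cands I \<and> card A \<le> seats I \<and> feasible I w"

text \<open>
  If \<open>supp I w c = 0\<close> then all weights \<open>w (n, c)\<close> of a feasible \<open>w\<close> vanish, so the value of the
  quotient by zero is immaterial.
\<close>

definition slack ::
  "('n, 'c) election \<Rightarrow> 'c set \<Rightarrow> ('n \<times> 'c \<Rightarrow> real) \<Rightarrow> 'n \<Rightarrow> real \<Rightarrow> real" where
  "slack I A w n t =
     strength I n - (\<Sum>c\<in>A \<inter> cands_of I n. w (n, c) * min 1 (t / supp I w c))"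

definition prescore ::
  "('n, 'c) election \<Rightarrow> 'c set \<Rightarrow> ('n \<times> 'c \<Rightarrow> real) \<Rightarrow> 'c \<Rightarrow> real \<Rightarrow> real" where
  "prescore I A w c t = (\<Sum>n\<in>voters_of I c. slack I A w n t)"

definition score ::
  "('n, 'c) election \<Rightarrow> 'c set \<Rightarrow> ('n \<times> 'c \<Rightarrow> real) \<Rightarrow> 'c \<Rightarrow> real" where
  "score I A w c = (GREATEST t. 0 \<le> t \<and> t \<le> prescore I A w c t)"


section \<open>A real random-access machine\<close>

text \<open>
  Algorithms are programs of a while language over natural-number and real registers and arrays,
  in which every operation and every memory access costs one unit. Naturals serve as indices and
  counters; they can only be added, subtracted (truncating at zero), halved and compared, so that
  unit cost gives no access to fast arithmetic on huge integers. Reals are manipulated only through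
  the field operations and comparisons; there is no rounding and no real constant other than
  natural numbers. Division by zero yields zero, which a program could also arrange by a test.
\<close>

datatype iexp =
    INum nat
  | IVar string
  | IArr string iexp
  | IAdd iexp iexp
  | ISub iexp iexp
  | IHalf iexp

datatype rexp =
    RNum nat
  | RVar string
  | RArr string iexp
  | RAdd rexp rexp
  | RSub rexp rexp
  | RMul rexp rexp
  | RDiv rexp rexp

datatype bexp =
    ILess iexp iexp
  | RLess rexp rexp
  | BNot bexp
  | BAnd bexp bexp

datatype com =
    Skip
  | ISet string iexp
  | RSet string rexp
  | IStore string iexp iexp
  | RStore string iexp rexp
  | Seq com com
  | Cond bexp com com
  | While bexp com

record state =
  ivar :: "string \<Rightarrow> nat"
  rvar :: "string \<Rightarrow> real"
  iarr :: "string \<Rightarrow> nat \<Rightarrow> nat"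
  rarr :: "string \<Rightarrow> nat \<Rightarrow> real"

primrec ival :: "iexp \<Rightarrow> state \<Rightarrow> nat" where
  "ival (INum m) \<sigma> = m"
| "ival (IVar x) \<sigma> = ivar \<sigma> x"
| "ival (IArr a e) \<sigma> = iarr \<sigma> a (ival e \<sigma>)"
| "ival (IAdd e f) \<sigma> = ival e \<sigma> + ival f \<sigma>"
| "ival (ISub e f) \<sigma> = ival e \<sigma> - ival f \<sigma>"
| "ival (IHalf e) \<sigma> = ival e \<sigma> div 2"

primrec rval :: "rexp \<Rightarrow> state \<Rightarrow> real" where
  "rval (RNum m) \<sigma> = real m"
| "rval (RVar x) \<sigma> = rvar \<sigma> x"
| "rval (RArr a e) \<sigma> = rarr \<sigma> a (ival e \<sigma>)"
| "rval (RAdd e f) \<sigma> = rval e \<sigma> + rval f \<sigma>"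
| "rval (RSub e f) \<sigma> = rval e \<sigma> - rval f \<sigma>"
| "rval (RMul e f) \<sigma> = rval e \<sigma> * rval f \<sigma>"
| "rval (RDiv e f) \<sigma> = rval e \<sigma> / rval f \<sigma>"

primrec bval :: "bexp \<Rightarrow> state \<Rightarrow> bool" where
  "bval (ILess e f) \<sigma> \<longleftrightarrow> ival e \<sigma> < ival f \<sigma>"
| "bval (RLess e f) \<sigma> \<longleftrightarrow> rval e \<sigma> < rval f \<sigma>"
| "bval (BNot b) \<sigma> \<longleftrightarrow> \<not> bval b \<sigma>"
| "bval (BAnd b d) \<sigma> \<longleftrightarrow> bval b \<sigma> \<and> bval d \<sigma>"

primrec icost :: "iexp \<Rightarrow> nat" where
  "icost (INum m) = 1"
| "icost (IVar x) = 1"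
| "icost (IArr a e) = icost e + 1"
| "icost (IAdd e f) = icost e + icost f + 1"
| "icost (ISub e f) = icost e + icost f + 1"
| "icost (IHalf e) = icost e + 1"

primrec rcost :: "rexp \<Rightarrow> nat" where
  "rcost (RNum m) = 1"
| "rcost (RVar x) = 1"
| "rcost (RArr a e) = icost e + 1"
| "rcost (RAdd e f) = rcost e + rcost f + 1"
| "rcost (RSub e f) = rcost e + rcost f + 1"
| "rcost (RMul e f) = rcost e + rcost f + 1"
| "rcost (RDiv e f) = rcost e + rcost f + 1"

primrec bcost :: "bexp \<Rightarrow> nat" where
  "bcost (ILess e f) = icost e + icost f + 1"
| "bcost (RLess e f) = rcost e + rcost f + 1"
| "bcost (BNot b) = bcost b + 1"
| "bcost (BAnd b d) = bcost b + bcost d + 1"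

text \<open>\<open>exec P \<sigma> T \<sigma>'\<close>: started in \<open>\<sigma>\<close>, the program \<open>P\<close> halts in \<open>\<sigma>'\<close> after exactly \<open>T\<close> units of time.\<close>

inductive exec :: "com \<Rightarrow> state \<Rightarrow> nat \<Rightarrow> state \<Rightarrow> bool" where
  Skip: "exec Skip \<sigma> 1 \<sigma>"
| ISet: "exec (ISet x e) \<sigma> (icost e + 1) (\<sigma>\<lparr>ivar := (ivar \<sigma>)(x := ival e \<sigma>)\<rparr>)"
| RSet: "exec (RSet x e) \<sigma> (rcost e + 1) (\<sigma>\<lparr>rvar := (rvar \<sigma>)(x := rval e \<sigma>)\<rparr>)"
| IStore: "exec (IStore a i e) \<sigma> (icost i + icost e + 1)
    (\<sigma>\<lparr>iarr := (iarr \<sigma>)(a := (iarr \<sigma> a)(ival i \<sigma> := ival e \<sigma>))\<rparr>)"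
| RStore: "exec (RStore a i e) \<sigma> (icost i + rcost e + 1)
    (\<sigma>\<lparr>rarr := (rarr \<sigma>)(a := (rarr \<sigma> a)(ival i \<sigma> := rval e \<sigma>))\<rparr>)"
| Seq: "\<lbrakk>exec P \<sigma> T \<sigma>'; exec Q \<sigma>' U \<sigma>''\<rbrakk> \<Longrightarrow> exec (Seq P Q) \<sigma> (T + U) \<sigma>''"
| CondTrue: "\<lbrakk>bval b \<sigma>; exec P \<sigma> T \<sigma>'\<rbrakk> \<Longrightarrow> exec (Cond b P Q) \<sigma> (bcost b + T + 1) \<sigma>'"
| CondFalse: "\<lbrakk>\<not> bval b \<sigma>; exec Q \<sigma> T \<sigma>'\<rbrakk> \<Longrightarrow> exec (Cond b P Q) \<sigma> (bcost b + T + 1) \<sigma>'"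
| WhileFalse: "\<not> bval b \<sigma> \<Longrightarrow> exec (While b P) \<sigma> (bcost b + 1) \<sigma>"
| WhileTrue: "\<lbrakk>bval b \<sigma>; exec P \<sigma> T \<sigma>'; exec (While b P) \<sigma>' U \<sigma>''\<rbrakk>
    \<Longrightarrow> exec (While b P) \<sigma> (bcost b + T + U + 1) \<sigma>''"

inductive_cases exec_SkipE: "exec Skip \<sigma> T \<sigma>'"
inductive_cases exec_ISetE: "exec (ISet x e) \<sigma> T \<sigma>'"
inductive_cases exec_RSetE: "exec (RSet x e) \<sigma> T \<sigma>'"
inductive_cases exec_IStoreE: "exec (IStore a i e) \<sigma> T \<sigma>'"
inductive_cases exec_RStoreE: "exec (RStore a i e) \<sigma> T \<sigma>'"
inductive_cases exec_SeqE: "exec (Seq P Q) \<sigma> T \<sigma>'"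
inductive_cases exec_CondE: "exec (Cond b P Q) \<sigma> T \<sigma>'"
inductive_cases exec_WhileE: "exec (While b P) \<sigma> T \<sigma>'"

lemma exec_deterministic:
  "exec P \<sigma> T \<sigma>' \<Longrightarrow> exec P \<sigma> U \<sigma>'' \<Longrightarrow> U = T \<and> \<sigma>'' = \<sigma>'"
proof (induction arbitrary: U \<sigma>'' rule: exec.induct)
  case Skip then show ?case by (elim exec_SkipE) simp
next
  case ISet then show ?case by (elim exec_ISetE) simp
next
  case RSet then show ?case by (elim exec_RSetE) simp
next
  case IStore then show ?case by (elim exec_IStoreE) simp
next
  case RStore then show ?case by (elim exec_RStoreE) simp
next
  case Seq
  from Seq.prems show ?case by (rule exec_SeqE) (metis Seq.IH)
next
  case CondTrue
  from CondTrue.prems show ?case by (rule exec_CondE) (use CondTrue.hyps(1) CondTrue.IH in force)+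
next
  case CondFalse
  from CondFalse.prems show ?case by (rule exec_CondE) (use CondFalse.hyps(1) CondFalse.IH in force)+
next
  case WhileFalse
  from WhileFalse.prems show ?case by (rule exec_WhileE) (use WhileFalse.hyps(1) in simp_all)
next
  case WhileTrue
  from WhileTrue.prems show ?case
    by (rule exec_WhileE) (use WhileTrue.hyps(1) WhileTrue.IH in force)+
qed

definition halts_within :: "com \<Rightarrow> state \<Rightarrow> real \<Rightarrow> (state \<Rightarrow> bool) \<Rightarrow> bool" where
  "halts_within P \<sigma> B Q \<longleftrightarrow> (\<exists>T \<sigma>'. exec P \<sigma> T \<sigma>' \<and> real T \<le> B \<and> Q \<sigma>')"


section \<open>Representation of the input in memory\<close>

text \<open>
  The lists \<open>vs\<close>, \<open>cs\<close>, \<open>es\<close>, \<open>sel\<close> enumerate the voters, the candidates, the edges and \<open>A\<close>, each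
  in arbitrary order; a vertex is represented by its position in \<open>vs\<close> or \<open>cs\<close>. The graph is stored
  as a plain list of edges together with their weights, and the supports of the members of \<open>A\<close> are
  stored alongside \<open>A\<close>. All memory not mentioned here has arbitrary initial contents.
\<close>

definition stores ::
  "state \<Rightarrow> ('n, 'c) election \<Rightarrow> 'c set \<Rightarrow> ('n \<times> 'c \<Rightarrow> real) \<Rightarrow>
    'n list \<Rightarrow> 'c list \<Rightarrow> ('n \<times> 'c) list \<Rightarrow> 'c list \<Rightarrow> bool" where
  "stores \<sigma> I A w vs cs es sel \<longleftrightarrow>
     distinct vs \<and> set vs = voters I \<and> distinct cs \<and> set cs = cands I \<and>
     distinct es \<and> set es = edges I \<and> distinct sel \<and> set sel = A \<and>
     ivar \<sigma> ''num_voters'' = length vs \<and> ivar \<sigma> ''num_cands'' = length cs \<and>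
     ivar \<sigma> ''num_edges'' = length es \<and> ivar \<sigma> ''num_selected'' = length sel \<and>
     ivar \<sigma> ''k'' = seats I \<and>
     (\<forall>i<length vs. rarr \<sigma> ''strength'' i = strength I (vs ! i)) \<and>
     (\<forall>j<length es.
        iarr \<sigma> ''edge_voter'' j < length vs \<and> iarr \<sigma> ''edge_cand'' j < length cs \<and>
        es ! j = (vs ! iarr \<sigma> ''edge_voter'' j, cs ! iarr \<sigma> ''edge_cand'' j) \<and>
        rarr \<sigma> ''weight'' j = w (es ! j)) \<and>
     (\<forall>j<length sel.
        iarr \<sigma> ''selected'' j < length cs \<and> sel ! j = cs ! iarr \<sigma> ''selected'' j \<and>
        rarr \<sigma> ''supp'' j = supp I w (sel ! j))"

text \<open>The candidate and the number returned by a program that has halted in the given state.\<close>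

definition returns :: "state \<Rightarrow> 'c list \<Rightarrow> 'c \<Rightarrow> real \<Rightarrow> bool" where
  "returns \<sigma> cs c r \<longleftrightarrow>
     ivar \<sigma> ''result_cand'' < length cs \<and> c = cs ! ivar \<sigma> ''result_cand'' \<and>
     r = rvar \<sigma> ''result_value''"

end

theory Submission
  imports Defs "HOL-Library.Sorting_Algorithms" "HOL-Library.Log_Nat"
begin

text \<open>
  For fixed \<open>t\<close>, every member \<open>c\<close> of \<open>A\<close> contributes a factor \<open>min 1 (t / supp c)\<close>; two sweeps over
  the edges turn the factors into slacks and the slacks into prescores.

  Prescores are antitone in \<open>t\<close>, so the score is the fixed point of the prescore, and \<open>t\<close> exceeds
  the maximum score iff it exceeds all prescores at \<open>t\<close>. After merge sorting the supports, a binary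
  search driven by the first algorithm therefore finds consecutive supports \<open>a\<close> and \<open>b\<close> with the
  maximum score between them (below the least support \<open>a = 0\<close>, above the largest \<open>b = a + 1\<close>).
  There every prescore coincides with its secant through \<open>a\<close> and \<open>b\<close>, whose fixed point is explicit.
  A maximiser of these fixed points also maximises the score: the two agree wherever one of them is
  at least \<open>a\<close>.
\<close>

section \<open>Fixed points of antitone functions\<close>

lemma le_fixpoint_iff:
  fixes f :: "'a::linorder \<Rightarrow> 'a"
  assumes "antimono f" "f s = s"
  shows "t \<le> s \<longleftrightarrow> t \<le> f t"
proof
  assume "t \<le> s"
  then show "t \<le> f t" using antimonoD[OF assms(1)] assms(2) by fastforce
next
  assume "t \<le> f t"
  then show "t \<le> s" by (metis antimonoD assms linear order_trans)
qed

lemma antimono_fixpoint_unique: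
  fixes f :: "'a::linorder \<Rightarrow> 'a"
  assumes "antimono f" "f s = s" "f t = t"
  shows "s = t"
  using le_fixpoint_iff[OF assms(1,2), of t] le_fixpoint_iff[OF assms(1,3), of s] assms by auto

lemma Max_fixpoint_transfer:
  fixes f g :: "'b \<Rightarrow> 'a::linorder \<Rightarrow> 'a"
  assumes "finite C" "c \<in> C"
    and f: "\<And>c. c \<in> C \<Longrightarrow> antimono (f c)" "\<And>c. c \<in> C \<Longrightarrow> f c (s c) = s c"
    and g: "\<And>c. c \<in> C \<Longrightarrow> antimono (g c)" "\<And>c. c \<in> C \<Longrightarrow> g c (r c) = r c"
    and eq: "\<And>c t. c \<in> C \<Longrightarrow> a \<le> t \<Longrightarrow> t \<le> Max (s ` C) \<Longrightarrow> f c t = g c t"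
    and "a \<le> Max (s ` C)" and max: "r c = Max (r ` C)"
  shows "r c = s c" "s c = Max (s ` C)"
proof -
  have le_Max: "s d \<le> Max (s ` C)" and r_le: "r d \<le> r c" if "d \<in> C" for d
    using that \<open>finite C\<close> by (simp_all add: max)
  have same: "r d = s d" if "d \<in> C" "a \<le> s d" for d
    using antimono_fixpoint_unique[OF g(1), of d "r d" "s d"] g(2) f(2) eq[of d "s d"] le_Max that
    by simp
  obtain m where m: "m \<in> C" "s m = Max (s ` C)"
    using Max_in[of "s ` C"] \<open>finite C\<close> \<open>c \<in> C\<close> by fastforce
  then have "s m \<le> r c" using same[of m] r_le[of m] \<open>a \<le> _\<close> by simp
  then have "a \<le> r c" using m(2) \<open>a \<le> _\<close> by simp
  then have "a \<le> f c a"
    using le_fixpoint_iff[OF g] eq[of c a] \<open>c \<in> C\<close> \<open>a \<le> Max _\<close> by simp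
  then show "r c = s c" using le_fixpoint_iff[OF f] same \<open>c \<in> C\<close> by simp
  then show "s c = Max (s ` C)" using \<open>s m \<le> r c\<close> m(2) le_Max[OF \<open>c \<in> C\<close>] by simp
qed

lemma Greatest_le_eq_fixpoint:
  fixes f :: "'a::linorder \<Rightarrow> 'a"
  assumes "antimono f" "f s = s" "b \<le> s"
  shows "(GREATEST t. b \<le> t \<and> t \<le> f t) = s"
  using le_fixpoint_iff[OF assms(1,2)] assms by (intro Greatest_equality) auto

lemma antimono_continuous_fixpoint:
  fixes f :: "real \<Rightarrow> real"
  assumes "antimono f" "continuous_on UNIV f" "b \<le> f b"
  obtains s where "b \<le> s" "f s = s"
proof -
  have "\<exists>s. b \<le> s \<and> s \<le> f b \<and> s - f s = 0"
    using assms(3) antimonoD[OF assms(1,3)] continuous_on_subset[OF assms(2)]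
    by (intro IVT' continuous_intros) auto
  with that show thesis by auto
qed

definition secant :: "(real \<Rightarrow> real) \<Rightarrow> real \<Rightarrow> real \<Rightarrow> real \<Rightarrow> real" where
  "secant f a b t = f a + (t - a) / (b - a) * (f b - f a)"

definition secant_fixpoint :: "(real \<Rightarrow> real) \<Rightarrow> real \<Rightarrow> real \<Rightarrow> real" where
  "secant_fixpoint f a b = (f a * (b - a) + a * (f a - f b)) / (b - a + (f a - f b))"

lemma antimono_secant:
  assumes "a < b" "f b \<le> f a"
  shows "antimono (secant f a b)"
  using assms by (intro antimonoI) (auto simp: secant_def divide_right_mono mult_right_mono_neg)

lemma secant_secant_fixpoint:
  assumes "a < b" "f b \<le> f a"
  shows "secant f a b (secant_fixpoint f a b) = secant_fixpoint f a b"
proof -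
  define d e where "d = b - a" and "e = f a - f b"
  let ?s = "secant_fixpoint f a b"
  have "d \<noteq> 0" "d + e \<noteq> 0" using assms by (auto simp: d_def e_def)
  have s: "?s = (f a * d + a * e) / (d + e)" by (simp add: secant_fixpoint_def d_def e_def)
  then have "?s - a = (f a - a) * d / (d + e)" using \<open>d + e \<noteq> 0\<close> by (simp add: field_simps)
  then have slope: "(?s - a) / d = (f a - a) / (d + e)" using \<open>d \<noteq> 0\<close> by simp
  have "secant f a b ?s = f a - (?s - a) / d * e"
    unfolding secant_def d_def e_def by (simp add: right_diff_distrib)
  also have "\<dots> = f a - (f a - a) / (d + e) * e" by (simp only: slope)
  also have "\<dots> = ?s" using \<open>d + e \<noteq> 0\<close> by (simp add: s field_simps)
  finally show ?thesis .
qed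

lemma min_1_divide_eq_secant:
  fixes s :: real
  assumes "0 \<le> a" "a < b" "a \<le> t" "0 \<le> s" "s \<le> a \<or> max b t \<le> s"
  shows "min 1 (t / s) = secant (\<lambda>t. min 1 (t / s)) a b t"
  using assms(5)
proof
  assume "s \<le> a"
  then show ?thesis using assms(1-4) by (cases "s = 0") (auto simp: secant_def min_def field_simps)
next
  assume "max b t \<le> s"
  then have "0 < s" and "min 1 (x / s) = x / s" if "x \<le> max b t" for x
    using assms(1,2) that by (auto simp: min_def)
  then show ?thesis
    using assms(2,3) by (simp add: secant_def flip: diff_divide_distrib add_divide_distrib)
qed

section \<open>Prescores and scores\<close>

locale solution =
  fixes I :: "('n, 'c) election" and A w
  assumes instance_I: "election_instance I" and solution_A: "partial_solution I A w"
begin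

lemma finite_edges: "finite (edges I)"
  using instance_I unfolding election_instance_def by (meson finite_SigmaI finite_subset)

lemma finite_cands: "finite (cands I)" and A_subset: "A \<subseteq> cands I"
  using instance_I solution_A by (auto simp: election_instance_def partial_solution_def)

lemma cands_of_iff_voters_of: "c \<in> cands_of I n \<longleftrightarrow> n \<in> voters_of I c"
  by (simp add: voters_of_def cands_of_def)

lemma finite_cands_of: "finite (cands_of I n)"
  using finite_edges unfolding cands_of_def by (rule finite_surj[where f = snd]) force

lemma weight_nonneg: "n \<in> voters_of I c \<Longrightarrow> 0 \<le> w (n, c)"
  using solution_A by (auto simp: partial_solution_def feasible_def voters_of_def)

lemma strength_nonneg: "n \<in> voters_of I c \<Longrightarrow> 0 \<le> strength I n"
  using instance_I by (auto simp: election_instance_def voters_of_def)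

lemma supp_nonneg: "0 \<le> supp I w c"
  unfolding supp_def by (intro sum_nonneg weight_nonneg)

abbreviation unselected :: "'c set" where
  "unselected \<equiv> cands I - A"

lemma unselected_nonempty: "unselected \<noteq> {}"
proof -
  have "card A < card (cands I)"
    using instance_I solution_A by (auto simp: election_instance_def partial_solution_def)
  then show ?thesis using A_subset by auto
qed

lemma antimono_prescore: "antimono (prescore I A w c)"
  unfolding prescore_def slack_def using supp_nonneg weight_nonneg
  by (intro antimonoI sum_mono diff_left_mono mult_left_mono min.mono)
     (auto simp: cands_of_iff_voters_of divide_right_mono)

lemma continuous_on_prescore: "continuous_on S (prescore I A w c)"
proof -
  have "prescore I A w c = (\<lambda>t. \<Sum>n\<in>voters_of I c. strength I n -
      (\<Sum>c'\<in>A \<inter> cands_of I n. w (n, c') * min 1 (t * inverse (supp I w c'))))"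
    by (intro ext) (simp add: prescore_def slack_def divide_inverse)
  then show ?thesis by (auto intro!: continuous_intros)
qed

lemma prescore_score: "prescore I A w c (score I A w c) = score I A w c"
  and score_nonneg: "0 \<le> score I A w c"
proof -
  have "0 \<le> prescore I A w c 0"
    by (auto simp: prescore_def slack_def intro!: sum_nonneg strength_nonneg)
  then obtain s where "0 \<le> s" "prescore I A w c s = s"
    using antimono_continuous_fixpoint[OF antimono_prescore continuous_on_prescore] by blast
  moreover from this have "score I A w c = s"
    unfolding score_def by (intro Greatest_le_eq_fixpoint antimono_prescore)
  ultimately show "prescore I A w c (score I A w c) = score I A w c" "0 \<le> score I A w c"
    by simp_all
qed

lemma prescore_eq_secant:
  assumes "0 \<le> a" "a < b" "a \<le> t" "\<And>c'. c' \<in> A \<Longrightarrow> supp I w c' \<le> a \<or> max b t \<le> supp I w c'"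
  shows "prescore I A w c t = secant (prescore I A w c) a b t"
proof -
  define k where "k = (t - a) / (b - a)"
  define m where "m c' x = min 1 (x / supp I w c')" for c' x
  have "m c' t = m c' a + k * (m c' b - m c' a)" if "c' \<in> A" for c'
    using min_1_divide_eq_secant[OF assms(1-3) supp_nonneg assms(4)[OF that]]
    by (simp add: m_def k_def secant_def)
  then have "prescore I A w c t = (\<Sum>n\<in>voters_of I c. strength I n -
      (\<Sum>c'\<in>A \<inter> cands_of I n. w (n, c') * (m c' a + k * (m c' b - m c' a))))"
    by (simp add: prescore_def slack_def m_def)
  also have "\<dots> = prescore I A w c a + k * (prescore I A w c b - prescore I A w c a)"
    by (simp add: prescore_def slack_def m_def sum.distrib sum_subtractf sum_distrib_left
        algebra_simps)
  finally show ?thesis by (simp add: secant_def k_def)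
qed

definition max_score :: real where
  "max_score = Max (score I A w ` unselected)"

lemma max_score_less_iff: "max_score < t \<longleftrightarrow> Max ((\<lambda>c. prescore I A w c t) ` unselected) < t"
  using finite_cands unselected_nonempty le_fixpoint_iff[OF antimono_prescore prescore_score]
  by (simp add: max_score_def Max_ge_iff flip: not_le)

lemma max_score_nonneg: "0 \<le> max_score"
  using finite_cands unselected_nonempty score_nonneg by (auto simp: max_score_def Max_ge_iff)

text \<open>All prescores are affine between \<open>a\<close> and the larger of \<open>b\<close> and the maximum score.\<close>

definition brackets :: "real \<Rightarrow> real \<Rightarrow> bool" where
  "brackets a b \<longleftrightarrow> 0 \<le> a \<and> a < b \<and> a \<le> max_score \<and>
     (\<forall>c\<in>A. supp I w c \<le> a \<or> max b max_score \<le> supp I w c)"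

definition secant_score :: "real \<Rightarrow> real \<Rightarrow> 'c \<Rightarrow> real" where
  "secant_score a b c = secant_fixpoint (prescore I A w c) a b"

lemma secant_score_maximiser:
  assumes "brackets a b" "c \<in> unselected" "secant_score a b c = Max (secant_score a b ` unselected)"
  shows "secant_score a b c = score I A w c" "score I A w c = Max (score I A w ` unselected)"
proof -
  have ab: "0 \<le> a" "a < b" "a \<le> Max (score I A w ` unselected)"
    and supps: "\<And>c. c \<in> A \<Longrightarrow> supp I w c \<le> a \<or> max b max_score \<le> supp I w c"
    using assms(1) by (auto simp: brackets_def max_score_def)
  have decr: "prescore I A w d b \<le> prescore I A w d a" for d
    using antimonoD[OF antimono_prescore] \<open>a < b\<close> by simp
  note antimono = antimono_secant[OF \<open>a < b\<close> decr]
  have fixpoint: "secant (prescore I A w d) a b (secant_score a b d) = secant_score a b d" for d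
    unfolding secant_score_def using \<open>a < b\<close> decr by (rule secant_secant_fixpoint)
  have eq: "prescore I A w d t = secant (prescore I A w d) a b t"
    if "a \<le> t" "t \<le> Max (score I A w ` unselected)" for d t
    using ab(1,2) that(1)
  proof (rule prescore_eq_secant)
    show "supp I w c' \<le> a \<or> max b t \<le> supp I w c'" if "c' \<in> A" for c'
      using supps[OF that] \<open>t \<le> _\<close> by (auto simp: max_score_def)
  qed
  have "finite unselected" using finite_cands by simp
  note transfer = Max_fixpoint_transfer[OF this assms(2) antimono_prescore prescore_score
      antimono fixpoint eq ab(3) assms(3)]
  show "secant_score a b c = score I A w c" "score I A w c = Max (score I A w ` unselected)"
    using transfer by simp_all
qed

end

section \<open>Cost-bounded Hoare logic\<close>

notation Seq (infixl ";;" 60)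

text \<open>Every loop is charged for a single iteration; the number of iterations is accounted for by the
  factor \<open>E\<close> of \<open>runs\<close>.\<close>

primrec unit_cost :: "com \<Rightarrow> nat" where
  "unit_cost Skip = 1"
| "unit_cost (ISet x e) = icost e + 1"
| "unit_cost (RSet x e) = rcost e + 1"
| "unit_cost (IStore a i e) = icost i + icost e + 1"
| "unit_cost (RStore a i e) = icost i + rcost e + 1"
| "unit_cost (P ;; Q) = unit_cost P + unit_cost Q"
| "unit_cost (Cond b P Q) = bcost b + unit_cost P + unit_cost Q + 1"
| "unit_cost (While b P) = 2 * (bcost b + 1) + unit_cost P"

definition runs :: "nat \<Rightarrow> com \<Rightarrow> state \<Rightarrow> (state \<Rightarrow> bool) \<Rightarrow> bool" where
  "runs E P \<sigma> q \<longleftrightarrow> (\<exists>T \<sigma>'. exec P \<sigma> T \<sigma>' \<and> T \<le> unit_cost P * E \<and> q \<sigma>')"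

definition hoare :: "nat \<Rightarrow> (state \<Rightarrow> bool) \<Rightarrow> com \<Rightarrow> (state \<Rightarrow> bool) \<Rightarrow> bool"
    ("(_) \<turnstile> (\<lbrace>_\<rbrace>/ _/ \<lbrace>_\<rbrace>)" [51, 0, 0, 0] 50) where
  "E \<turnstile> \<lbrace>p\<rbrace> P \<lbrace>q\<rbrace> \<longleftrightarrow> (\<forall>\<sigma>. p \<sigma> \<longrightarrow> runs E P \<sigma> q)"

primrec writes :: "com \<Rightarrow> string set" where
  "writes Skip = {}"
| "writes (ISet x e) = {x}"
| "writes (RSet x e) = {x}"
| "writes (IStore a i e) = {a}"
| "writes (RStore a i e) = {a}"
| "writes (P ;; Q) = writes P \<union> writes Q"
| "writes (Cond b P Q) = writes P \<union> writes Q"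
| "writes (While b P) = writes P"

definition agree_except :: "string set \<Rightarrow> state \<Rightarrow> state \<Rightarrow> bool" where
  "agree_except X \<sigma> \<sigma>' \<longleftrightarrow> (\<forall>x. x \<notin> X \<longrightarrow> ivar \<sigma>' x = ivar \<sigma> x \<and> rvar \<sigma>' x = rvar \<sigma> x \<and>
     iarr \<sigma>' x = iarr \<sigma> x \<and> rarr \<sigma>' x = rarr \<sigma> x)"

definition unaffected :: "string set \<Rightarrow> (state \<Rightarrow> bool) \<Rightarrow> bool" where
  "unaffected X p \<longleftrightarrow> (\<forall>\<sigma> \<sigma>'. p \<sigma> \<longrightarrow> agree_except X \<sigma> \<sigma>' \<longrightarrow> p \<sigma>')"

lemma agree_exceptD:
  assumes "agree_except X \<sigma> \<sigma>'" "x \<notin> X"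
  shows "ivar \<sigma>' x = ivar \<sigma> x" "rvar \<sigma>' x = rvar \<sigma> x" "iarr \<sigma>' x = iarr \<sigma> x" "rarr \<sigma>' x = rarr \<sigma> x"
  using assms by (auto simp: agree_except_def)

lemma exec_agree_except: "exec P \<sigma> T \<sigma>' \<Longrightarrow> agree_except (writes P) \<sigma> \<sigma>'"
  by (induction rule: exec.induct) (auto simp: agree_except_def)

lemma unaffectedD: "unaffected X p \<Longrightarrow> p \<sigma> \<Longrightarrow> agree_except Y \<sigma> \<sigma>' \<Longrightarrow> Y \<subseteq> X \<Longrightarrow> p \<sigma>'"
  unfolding unaffected_def agree_except_def by (meson subsetD)

lemma unaffected_conj:
  "unaffected X p \<Longrightarrow> unaffected X q \<Longrightarrow> unaffected X (\<lambda>\<sigma>. p \<sigma> \<and> q \<sigma>)"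
  by (auto simp: unaffected_def)

lemma runs_conseq:
  assumes "runs E P \<sigma> q" "\<And>\<sigma>'. q \<sigma>' \<Longrightarrow> agree_except (writes P) \<sigma> \<sigma>' \<Longrightarrow> q' \<sigma>'"
  shows "runs E P \<sigma> q'"
  using assms exec_agree_except unfolding runs_def by meson

lemma hoare_conseq:
  assumes "E \<turnstile> \<lbrace>p\<rbrace> P \<lbrace>q\<rbrace>" "E \<le> E'" "\<And>\<sigma>. p' \<sigma> \<Longrightarrow> p \<sigma>"
    and "\<And>\<sigma> \<sigma>'. p' \<sigma> \<Longrightarrow> q \<sigma>' \<Longrightarrow> agree_except (writes P) \<sigma> \<sigma>' \<Longrightarrow> q' \<sigma>'"
  shows "E' \<turnstile> \<lbrace>p'\<rbrace> P \<lbrace>q'\<rbrace>"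
  using assms exec_agree_except unfolding hoare_def runs_def by (meson le_trans mult_le_mono2)

lemma hoare_fix_value:
  assumes "\<And>k. E \<turnstile> \<lbrace>\<lambda>\<sigma>. p \<sigma> \<and> f \<sigma> = k\<rbrace> P \<lbrace>q\<rbrace>"
  shows "E \<turnstile> \<lbrace>p\<rbrace> P \<lbrace>q\<rbrace>"
  using assms by (simp add: hoare_def)

lemma hoare_frame:
  assumes "E \<turnstile> \<lbrace>p\<rbrace> P \<lbrace>q\<rbrace>" "unaffected (writes P) r"
  shows "E \<turnstile> \<lbrace>\<lambda>\<sigma>. p \<sigma> \<and> r \<sigma>\<rbrace> P \<lbrace>\<lambda>\<sigma>. q \<sigma> \<and> r \<sigma>\<rbrace>"
  using assms by (auto simp: unaffected_def intro: hoare_conseq)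

lemma runs_exec:
  assumes "exec P \<sigma> T \<sigma>'" "T \<le> unit_cost P" "0 < E" "q \<sigma>'"
  shows "runs E P \<sigma> q"
  using assms unfolding runs_def
  by (metis le_trans mult_le_mono2 nat_mult_1_right Suc_leI One_nat_def)

lemma runs_Skip: "0 < E \<Longrightarrow> q \<sigma> \<Longrightarrow> runs E Skip \<sigma> q"
  by (rule runs_exec[OF exec.Skip]) auto

lemma runs_ISet: "0 < E \<Longrightarrow> q (\<sigma>\<lparr>ivar := (ivar \<sigma>)(x := ival e \<sigma>)\<rparr>) \<Longrightarrow> runs E (ISet x e) \<sigma> q"
  by (rule runs_exec[OF exec.ISet]) auto

lemma runs_RSet: "0 < E \<Longrightarrow> q (\<sigma>\<lparr>rvar := (rvar \<sigma>)(x := rval e \<sigma>)\<rparr>) \<Longrightarrow> runs E (RSet x e) \<sigma> q"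
  by (rule runs_exec[OF exec.RSet]) auto

lemma runs_RStore:
  "0 < E \<Longrightarrow> q (\<sigma>\<lparr>rarr := (rarr \<sigma>)(a := (rarr \<sigma> a)(ival i \<sigma> := rval e \<sigma>))\<rparr>) \<Longrightarrow>
    runs E (RStore a i e) \<sigma> q"
  by (rule runs_exec[OF exec.RStore]) auto

lemma runs_Seq: "runs E P \<sigma> (\<lambda>\<sigma>'. runs E Q \<sigma>' q) \<Longrightarrow> runs E (P ;; Q) \<sigma> q"
  unfolding runs_def by (force intro: exec.Seq simp: distrib_right)

lemma runs_Cond:
  assumes "0 < E" "bval b \<sigma> \<Longrightarrow> runs E P \<sigma> q" "\<not> bval b \<sigma> \<Longrightarrow> runs E Q \<sigma> q"
  shows "runs E (Cond b P Q) \<sigma> q"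
proof -
  have "\<exists>T \<sigma>'. exec (Cond b P Q) \<sigma> (bcost b + T + 1) \<sigma>' \<and>
      T \<le> (unit_cost P + unit_cost Q) * E \<and> q \<sigma>'"
    using assms(2,3) exec.CondTrue[of b \<sigma> P _ _ Q] exec.CondFalse[of b \<sigma> Q _ _ P]
    unfolding runs_def distrib_right by (metis trans_le_add1 trans_le_add2)
  moreover have "bcost b + 1 \<le> (bcost b + 1) * E"
    using assms(1) mult_le_mono2[of 1 E "bcost b + 1"] by simp
  ultimately show ?thesis
    unfolding runs_def by (fastforce simp: distrib_right)
qed

lemmas runs_intros = runs_Skip runs_ISet runs_RSet runs_RStore runs_Seq runs_Cond

lemma hoareI: "(\<And>\<sigma>. p \<sigma> \<Longrightarrow> runs E P \<sigma> q) \<Longrightarrow> E \<turnstile> \<lbrace>p\<rbrace> P \<lbrace>q\<rbrace>"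
  by (simp add: hoare_def)

lemma hoareD: "E \<turnstile> \<lbrace>p\<rbrace> P \<lbrace>q\<rbrace> \<Longrightarrow> p \<sigma> \<Longrightarrow> runs E P \<sigma> q"
  by (simp add: hoare_def)

lemma hoare_Seq [trans]:
  assumes "E \<turnstile> \<lbrace>p\<rbrace> P \<lbrace>q\<rbrace>" "E \<turnstile> \<lbrace>q\<rbrace> Q \<lbrace>r\<rbrace>"
  shows "E \<turnstile> \<lbrace>p\<rbrace> P ;; Q \<lbrace>r\<rbrace>"
  by (intro hoareI runs_Seq) (blast intro: runs_conseq hoareD assms)

lemma exec_While_invariant:
  assumes body: "\<And>v. E \<turnstile> \<lbrace>\<lambda>\<sigma>. Inv (Suc v) \<sigma> \<and> bval b \<sigma>\<rbrace> P \<lbrace>Inv v\<rbrace>"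
    and exit: "\<And>\<sigma>. Inv 0 \<sigma> \<Longrightarrow> \<not> bval b \<sigma>" and "Inv v \<sigma>"
  shows "\<exists>T \<sigma>'. exec (While b P) \<sigma> T \<sigma>' \<and>
    T \<le> v * (bcost b + 1 + unit_cost P * E) + (bcost b + 1) \<and> \<not> bval b \<sigma>' \<and> (\<exists>u. Inv u \<sigma>')"
  using \<open>Inv v \<sigma>\<close>
proof (induction v arbitrary: \<sigma>)
  case 0
  with exit[OF 0] show ?case using exec.WhileFalse[of b \<sigma> P] by fastforce
next
  case (Suc v)
  show ?case
  proof (cases "bval b \<sigma>")
    case True
    then obtain T \<sigma>' where P: "exec P \<sigma> T \<sigma>'" "T \<le> unit_cost P * E" "Inv v \<sigma>'"
      using hoareD[OF body] Suc.prems unfolding runs_def by blast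
    obtain U \<sigma>'' where loop: "exec (While b P) \<sigma>' U \<sigma>''"
        "U \<le> v * (bcost b + 1 + unit_cost P * E) + (bcost b + 1)"
      and post: "\<not> bval b \<sigma>''" "\<exists>u. Inv u \<sigma>''"
      using Suc.IH[OF P(3)] by blast
    show ?thesis
      using exec.WhileTrue[OF True P(1) loop(1)] P(2) loop(2) post by fastforce
  next
    case False
    with Suc.prems show ?thesis using exec.WhileFalse[of b \<sigma> P] by fastforce
  qed
qed

lemma hoare_While:
  assumes "\<And>v. E \<turnstile> \<lbrace>\<lambda>\<sigma>. Inv (Suc v) \<sigma> \<and> bval b \<sigma>\<rbrace> P \<lbrace>Inv v\<rbrace>"
    and "\<And>\<sigma>. Inv 0 \<sigma> \<Longrightarrow> \<not> bval b \<sigma>"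
    and "v \<le> L" "0 < E" "0 < L"
  shows "E * L \<turnstile> \<lbrace>Inv v\<rbrace> While b P \<lbrace>\<lambda>\<sigma>. \<not> bval b \<sigma> \<and> (\<exists>u. Inv u \<sigma>)\<rbrace>"
proof -
  let ?B = "bcost b + 1" and ?C = "unit_cost P * E"
  have "?B \<le> ?B * E" using \<open>0 < E\<close> mult_le_mono2[of 1 E ?B] by simp
  moreover have "?B * E \<le> L * (?B * E)" using \<open>0 < L\<close> mult_le_mono1[of 1 L "?B * E"] by simp
  ultimately have "v * (?B + ?C) + ?B \<le> L * (?B * E + ?C) + L * (?B * E)"
    using \<open>v \<le> L\<close> by (intro add_mono mult_le_mono) linarith+
  also have "\<dots> = unit_cost (While b P) * (E * L)" by (simp add: algebra_simps)
  finally show ?thesis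
    using exec_While_invariant[where Inv = Inv and E = E, OF assms(1,2)]
    unfolding hoare_def runs_def by (meson le_trans)
qed

definition For :: "string \<Rightarrow> string \<Rightarrow> com \<Rightarrow> com" where
  "For i n P = ISet i (INum 0) ;;
     While (ILess (IVar i) (IVar n)) (P ;; ISet i (IAdd (IVar i) (INum 1)))"

lemma writes_For [simp]: "writes (For i n P) = insert i (writes P)"
  by (auto simp: For_def)

lemma hoare_For:
  assumes body: "\<And>j \<sigma>. j < N \<Longrightarrow> ivar \<sigma> i = j \<Longrightarrow> r \<sigma> \<Longrightarrow> Inv j \<sigma> \<Longrightarrow> runs 1 P \<sigma> (Inv (Suc j))"
    and r: "unaffected (insert i (writes P)) r" "\<And>\<sigma>. r \<sigma> \<Longrightarrow> ivar \<sigma> n = N"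
    and Inv: "\<And>j. unaffected {i} (Inv j)"
    and "i \<notin> writes P" "N \<le> E" "0 < E"
  shows "E \<turnstile> \<lbrace>\<lambda>\<sigma>. r \<sigma> \<and> Inv 0 \<sigma>\<rbrace> For i n P \<lbrace>\<lambda>\<sigma>. r \<sigma> \<and> Inv N \<sigma>\<rbrace>"
proof -
  let ?b = "ILess (IVar i) (IVar n)" and ?incr = "ISet i (IAdd (IVar i) (INum 1))"
  define Remaining where "Remaining v \<sigma> \<longleftrightarrow> v + ivar \<sigma> i = N \<and> r \<sigma> \<and> Inv (ivar \<sigma> i) \<sigma>" for v \<sigma>
  have set_i: "r (\<sigma>\<lparr>ivar := (ivar \<sigma>)(i := v)\<rparr>)" "Inv j (\<sigma>\<lparr>ivar := (ivar \<sigma>)(i := v)\<rparr>)"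
    if "r \<sigma>" "Inv j \<sigma>" for j v \<sigma>
    using that unaffectedD[OF r(1), of \<sigma> "{i}"] unaffectedD[OF Inv, of j \<sigma> "{i}"]
    by (auto simp: agree_except_def)
  have "E \<turnstile> \<lbrace>\<lambda>\<sigma>. r \<sigma> \<and> Inv 0 \<sigma>\<rbrace> ISet i (INum 0) \<lbrace>Remaining N\<rbrace>"
    using \<open>0 < E\<close> set_i by (intro hoareI runs_ISet) (auto simp: Remaining_def)
  also have "E \<turnstile> \<lbrace>Remaining N\<rbrace> While ?b (P ;; ?incr) \<lbrace>\<lambda>\<sigma>. r \<sigma> \<and> Inv N \<sigma>\<rbrace>"
  proof (rule hoare_conseq[OF hoare_While[where E = 1 and L = E and v = N and Inv = Remaining]])
    fix v
    show "1 \<turnstile> \<lbrace>\<lambda>\<sigma>. Remaining (Suc v) \<sigma> \<and> bval ?b \<sigma>\<rbrace> P ;; ?incr \<lbrace>Remaining v\<rbrace>"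
    proof (intro hoareI runs_Seq, elim conjE)
      fix \<sigma> assume remaining: "Remaining (Suc v) \<sigma>"
      then have "runs 1 P \<sigma> (Inv (Suc (ivar \<sigma> i)))" by (intro body) (auto simp: Remaining_def)
      then show "runs 1 P \<sigma> (\<lambda>\<sigma>'. runs 1 ?incr \<sigma>' (Remaining v))"
      proof (rule runs_conseq)
        fix \<sigma>' assume Inv': "Inv (Suc (ivar \<sigma> i)) \<sigma>'" and agree: "agree_except (writes P) \<sigma> \<sigma>'"
        have "r \<sigma>'" using unaffectedD[OF r(1) _ agree] remaining by (auto simp: Remaining_def)
        moreover have "ivar \<sigma>' i = ivar \<sigma> i" using agree_exceptD[OF agree] assms(5) by simp
        ultimately show "runs 1 ?incr \<sigma>' (Remaining v)"
          using Inv' remaining set_i by (intro runs_ISet) (auto simp: Remaining_def)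
      qed
    qed
  qed (use assms in \<open>auto simp: Remaining_def\<close>)
  finally show ?thesis unfolding For_def .
qed

lemma halts_within_hoare:
  assumes "E \<turnstile> \<lbrace>p\<rbrace> P \<lbrace>q\<rbrace>" "p \<sigma>" "real (unit_cost P * E) \<le> B"
  shows "halts_within P \<sigma> B q"
  using assms unfolding hoare_def runs_def halts_within_def by (meson of_nat_le_iff order_trans)

section \<open>Array programs\<close>

definition array_holds :: "(nat \<Rightarrow> 'a) \<Rightarrow> 'a list \<Rightarrow> bool" where
  "array_holds a xs \<longleftrightarrow> (\<forall>i<length xs. a i = xs ! i)"

definition array_indexes :: "(nat \<Rightarrow> nat) \<Rightarrow> 'a list \<Rightarrow> 'a list \<Rightarrow> bool" where
  "array_indexes a xs ys \<longleftrightarrow> (\<forall>j<length ys. a j < length xs \<and> xs ! a j = ys ! j)"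

lemma array_holds_map_upt: "array_holds a xs \<longleftrightarrow> map a [0..<length xs] = xs"
  unfolding array_holds_def by (subst list_eq_iff_nth_eq) simp

lemma hoare_tabulate:
  assumes body: "\<And>j \<sigma>. j < length xs \<Longrightarrow> ivar \<sigma> i = j \<Longrightarrow> r \<sigma> \<Longrightarrow>
      runs 1 P \<sigma> (\<lambda>\<sigma>'. rarr \<sigma>' a = (rarr \<sigma> a)(j := f (xs ! j)))"
    and "writes P = {a}" "i \<noteq> a" "unaffected {i, a} r"
    and "\<And>\<sigma>. r \<sigma> \<Longrightarrow> ivar \<sigma> n = length xs" "length xs \<le> E" "0 < E"
  shows "E \<turnstile> \<lbrace>r\<rbrace> For i n P \<lbrace>\<lambda>\<sigma>. r \<sigma> \<and> array_holds (rarr \<sigma> a) (map f xs)\<rbrace>"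
proof -
  define Inv :: "nat \<Rightarrow> state \<Rightarrow> bool" where "Inv j \<sigma> \<longleftrightarrow> (\<forall>l<j. rarr \<sigma> a l = f (xs ! l))" for j \<sigma>
  have "E \<turnstile> \<lbrace>\<lambda>\<sigma>. r \<sigma> \<and> Inv 0 \<sigma>\<rbrace> For i n P \<lbrace>\<lambda>\<sigma>. r \<sigma> \<and> Inv (length xs) \<sigma>\<rbrace>"
  proof (rule hoare_For)
    fix j \<sigma> assume "j < length xs" "ivar \<sigma> i = j" "r \<sigma>" "Inv j \<sigma>"
    then show "runs 1 P \<sigma> (Inv (Suc j))"
      by (intro runs_conseq[OF body]) (auto simp: Inv_def less_Suc_eq)
  qed (use assms in \<open>auto simp: Inv_def unaffected_def agree_except_def\<close>)
  then show ?thesis by (simp add: Inv_def array_holds_def)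
qed

definition copy_com :: "string \<Rightarrow> string \<Rightarrow> string \<Rightarrow> com" where
  "copy_com a b n = For ''i'' n (RStore b (IVar ''i'') (RArr a (IVar ''i'')))"

lemma writes_copy_com [simp]: "writes (copy_com a b n) = {''i'', b}"
  by (auto simp: copy_com_def)

lemma hoare_copy:
  assumes "\<And>\<sigma>. r \<sigma> \<Longrightarrow> ivar \<sigma> n = length xs \<and> array_holds (rarr \<sigma> a) xs"
    and "unaffected (writes (copy_com a b n)) r" "b \<noteq> ''i''" "length xs \<le> E" "0 < E"
  shows "E \<turnstile> \<lbrace>r\<rbrace> copy_com a b n \<lbrace>\<lambda>\<sigma>. r \<sigma> \<and> array_holds (rarr \<sigma> b) xs\<rbrace>"
proof -
  have "E \<turnstile> \<lbrace>r\<rbrace> copy_com a b n \<lbrace>\<lambda>\<sigma>. r \<sigma> \<and> array_holds (rarr \<sigma> b) (map id xs)\<rbrace>"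
    unfolding copy_com_def using assms
    by (intro hoare_tabulate) (auto simp: array_holds_def intro!: runs_RStore)
  then show ?thesis by simp
qed

definition scatter_add :: "string \<Rightarrow> string \<Rightarrow> rexp \<Rightarrow> string \<Rightarrow> string \<Rightarrow> rexp \<Rightarrow> com" where
  "scatter_add a n d m ix e =
     For ''i'' n (RStore a (IVar ''i'') d) ;;
     For ''i'' m (RStore a (IArr ix (IVar ''i'')) (RAdd (RArr a (IArr ix (IVar ''i''))) e))"

lemma writes_scatter_add [simp]: "writes (scatter_add a n d m ix e) = {''i'', a}"
  by (auto simp: scatter_add_def)

lemma hoare_scatter_add:
  assumes r: "\<And>\<sigma>. r \<sigma> \<Longrightarrow> ivar \<sigma> n = length xs \<and> ivar \<sigma> m = length ys \<and>
      array_indexes (iarr \<sigma> ix) xs (map \<kappa> ys)"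
    and d: "\<And>\<sigma> j. r \<sigma> \<Longrightarrow> ivar \<sigma> ''i'' = j \<Longrightarrow> j < length xs \<Longrightarrow> rval d \<sigma> = f (xs ! j)"
    and e: "\<And>\<sigma> j. r \<sigma> \<Longrightarrow> ivar \<sigma> ''i'' = j \<Longrightarrow> j < length ys \<Longrightarrow> rval e \<sigma> = g (ys ! j)"
    and unaffected: "unaffected {''i'', a} r" and "a \<noteq> ''i''"
    and "distinct xs" "length xs \<le> E" "length ys \<le> E" "0 < E"
  shows "E \<turnstile> \<lbrace>r\<rbrace> scatter_add a n d m ix e \<lbrace>\<lambda>\<sigma>. r \<sigma> \<and>
    array_holds (rarr \<sigma> a) (map (\<lambda>x. f x + (\<Sum>y\<leftarrow>filter (\<lambda>y. \<kappa> y = x) ys. g y)) xs)\<rbrace>"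
proof -
  define Inv :: "nat \<Rightarrow> state \<Rightarrow> bool" where "Inv j \<sigma> \<longleftrightarrow> array_holds (rarr \<sigma> a)
    (map (\<lambda>x. f x + (\<Sum>y\<leftarrow>filter (\<lambda>y. \<kappa> y = x) (take j ys). g y)) xs)" for j \<sigma>
  have "E \<turnstile> \<lbrace>r\<rbrace> For ''i'' n (RStore a (IVar ''i'') d)
      \<lbrace>\<lambda>\<sigma>. r \<sigma> \<and> array_holds (rarr \<sigma> a) (map f xs)\<rbrace>"
    using assms by (intro hoare_tabulate) (auto intro!: runs_RStore)
  then have "E \<turnstile> \<lbrace>r\<rbrace> For ''i'' n (RStore a (IVar ''i'') d) \<lbrace>\<lambda>\<sigma>. r \<sigma> \<and> Inv 0 \<sigma>\<rbrace>"
    by (simp add: Inv_def)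
  also have "E \<turnstile> \<lbrace>\<dots>\<rbrace>
      For ''i'' m (RStore a (IArr ix (IVar ''i'')) (RAdd (RArr a (IArr ix (IVar ''i''))) e))
      \<lbrace>\<lambda>\<sigma>. r \<sigma> \<and> Inv (length ys) \<sigma>\<rbrace>"
  proof (rule hoare_For)
    fix j \<sigma> assume j: "j < length ys" "ivar \<sigma> ''i'' = j" and "r \<sigma>" "Inv j \<sigma>"
    have target: "iarr \<sigma> ix j < length xs" "xs ! iarr \<sigma> ix j = \<kappa> (ys ! j)"
      using r[OF \<open>r \<sigma>\<close>] j by (auto simp: array_indexes_def)
    then have "iarr \<sigma> ix j = l \<longleftrightarrow> \<kappa> (ys ! j) = xs ! l" if "l < length xs" for l
      using \<open>distinct xs\<close> that by (metis nth_eq_iff_index_eq)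
    with target j \<open>Inv j \<sigma>\<close> e[OF \<open>r \<sigma>\<close>]
    show "runs 1 (RStore a (IArr ix (IVar ''i'')) (RAdd (RArr a (IArr ix (IVar ''i''))) e)) \<sigma>
        (Inv (Suc j))"
      by (intro runs_RStore) (auto simp: Inv_def array_holds_def take_Suc_conv_app_nth)
  qed (use assms in \<open>auto simp: Inv_def unaffected_def agree_except_def\<close>)
  finally show ?thesis by (simp add: scatter_add_def Inv_def)
qed

text \<open>The index \<open>num_cands\<close> stands for the absence of a best candidate so far.\<close>

definition argmax_step_com :: "string \<Rightarrow> com" where
  "argmax_step_com a =
     Cond (BAnd (RLess (RArr ''taken'' (IVar ''i'')) (RNum 1))
         (BNot (BAnd (ILess (IVar ''result_cand'') (IVar ''num_cands''))
           (BNot (RLess (RVar ''result_value'') (RArr a (IVar ''i'')))))))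
       (ISet ''result_cand'' (IVar ''i'') ;; RSet ''result_value'' (RArr a (IVar ''i'')))
       Skip"

definition argmax_com :: "string \<Rightarrow> com" where
  "argmax_com a =
     ISet ''result_cand'' (IVar ''num_cands'') ;; For ''i'' ''num_cands'' (argmax_step_com a)"

lemma writes_argmax_com [simp]: "writes (argmax_com a) = {''i'', ''result_cand'', ''result_value''}"
  by (auto simp: argmax_com_def argmax_step_com_def)

definition returns_max :: "state \<Rightarrow> 'c list \<Rightarrow> ('c \<Rightarrow> real) \<Rightarrow> 'c set \<Rightarrow> bool" where
  "returns_max \<sigma> cs f C \<longleftrightarrow> (\<exists>c\<in>C. returns \<sigma> cs c (f c) \<and> f c = Max (f ` C))"

lemma returns_maxI:
  assumes "ivar \<sigma> ''result_cand'' < length cs" "cs ! ivar \<sigma> ''result_cand'' \<in> C" "finite C"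
    and "rvar \<sigma> ''result_value'' = f (cs ! ivar \<sigma> ''result_cand'')"
    and "\<And>c. c \<in> C \<Longrightarrow> f c \<le> rvar \<sigma> ''result_value''"
  shows "returns_max \<sigma> cs f C"
proof -
  have "f (cs ! ivar \<sigma> ''result_cand'') = Max (f ` C)"
    using assms(2-5) by (intro Max_eqI[symmetric]) auto
  then show ?thesis
    using assms(1,4) unfolding returns_max_def returns_def by (intro bexI[OF _ assms(2)]) simp
qed

lemma hoare_argmax:
  assumes "set cs - A \<noteq> {}" "length cs \<le> E" "a \<notin> writes (argmax_com a)"
  shows "E \<turnstile> \<lbrace>\<lambda>\<sigma>. ivar \<sigma> ''num_cands'' = length cs \<and> array_holds (rarr \<sigma> a) (map f cs) \<and>
      array_holds (rarr \<sigma> ''taken'') (map (\<lambda>c. of_bool (c \<in> A)) cs)\<rbrace>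
    argmax_com a \<lbrace>\<lambda>\<sigma>. returns_max \<sigma> cs f (set cs - A)\<rbrace>"
    (is "_ \<turnstile> \<lbrace>?r\<rbrace> _ \<lbrace>_\<rbrace>")
proof -
  let ?best = "\<lambda>\<sigma>. ivar \<sigma> ''result_cand''" and ?val = "\<lambda>\<sigma>. rvar \<sigma> ''result_value''"
  define Inv :: "nat \<Rightarrow> state \<Rightarrow> bool" where "Inv j \<sigma> \<longleftrightarrow>
    (?best \<sigma> < length cs \<longrightarrow> cs ! ?best \<sigma> \<notin> A \<and> ?val \<sigma> = f (cs ! ?best \<sigma>)) \<and>
    (\<forall>l<j. cs ! l \<notin> A \<longrightarrow> ?best \<sigma> < length cs \<and> f (cs ! l) \<le> ?val \<sigma>)" for j \<sigma>
  have "0 < E" using assms by (cases cs) auto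
  then have "E \<turnstile> \<lbrace>?r\<rbrace> ISet ''result_cand'' (IVar ''num_cands'') \<lbrace>\<lambda>\<sigma>. ?r \<sigma> \<and> Inv 0 \<sigma>\<rbrace>"
    by (intro hoareI runs_ISet) (auto simp: Inv_def)
  also have "E \<turnstile> \<lbrace>\<dots>\<rbrace> For ''i'' ''num_cands'' (argmax_step_com a)
      \<lbrace>\<lambda>\<sigma>. ?r \<sigma> \<and> Inv (length cs) \<sigma>\<rbrace>"
  proof (rule hoare_For)
    fix j \<sigma> assume j: "j < length cs" "ivar \<sigma> ''i'' = j" and "?r \<sigma>" and "Inv j \<sigma>"
    then have "rarr \<sigma> a j = f (cs ! j)" "rarr \<sigma> ''taken'' j = of_bool (cs ! j \<in> A)"
      and "ivar \<sigma> ''num_cands'' = length cs"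
      by (simp_all add: array_holds_def)
    with j \<open>Inv j \<sigma>\<close> show "runs 1 (argmax_step_com a) \<sigma> (Inv (Suc j))"
      unfolding argmax_step_com_def
      by (intro runs_intros) (auto simp: Inv_def less_Suc_eq split: if_splits)
  qed (use assms \<open>0 < E\<close> in
      \<open>auto simp: Inv_def unaffected_def agree_except_def argmax_step_com_def\<close>)
  finally show ?thesis
    unfolding argmax_com_def
  proof (rule hoare_conseq)
    fix \<sigma> assume "?r \<sigma> \<and> Inv (length cs) \<sigma>"
    then have Inv: "Inv (length cs) \<sigma>" by simp
    have le: "?best \<sigma> < length cs \<and> f c \<le> ?val \<sigma>" if "c \<in> set cs - A" for c
      using that Inv by (auto simp: Inv_def in_set_conv_nth)
    with assms(1) have "?best \<sigma> < length cs" by blast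
    with Inv le show "returns_max \<sigma> cs f (set cs - A)"
      by (intro returns_maxI) (auto simp: Inv_def)
  qed simp_all
qed

definition bisect_step_com :: "com \<Rightarrow> bexp \<Rightarrow> com" where
  "bisect_step_com P b =
     ISet ''pivot'' (IHalf (IAdd (IVar ''first'') (IVar ''last''))) ;; P ;;
     Cond b (ISet ''last'' (IVar ''pivot'')) (ISet ''first'' (IAdd (IVar ''pivot'') (INum 1)))"

definition bisect_com :: "string \<Rightarrow> com \<Rightarrow> bexp \<Rightarrow> com" where
  "bisect_com n P b =
     ISet ''first'' (INum 0) ;; ISet ''last'' (IVar n) ;;
     While (ILess (IVar ''first'') (IVar ''last'')) (bisect_step_com P b)"

definition bisect_inv :: "nat \<Rightarrow> (nat \<Rightarrow> bool) \<Rightarrow> nat \<Rightarrow> nat \<Rightarrow> nat \<Rightarrow> bool" where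
  "bisect_inv N \<phi> v lo hi \<longleftrightarrow> lo \<le> hi \<and> hi \<le> N \<and> hi - lo < 2 ^ v \<and>
     (\<forall>q<lo. \<not> \<phi> q) \<and> (\<forall>q<N. hi \<le> q \<longrightarrow> \<phi> q)"

lemma bisect_inv_lower:
  assumes "bisect_inv N \<phi> (Suc v) lo hi" "lo < hi" "\<phi> ((lo + hi) div 2)" "mono_on {..<N} \<phi>"
  shows "bisect_inv N \<phi> v lo ((lo + hi) div 2)"
proof -
  have "\<phi> q" if "q < N" "(lo + hi) div 2 \<le> q" for q
    using mono_onD[OF assms(4), of "(lo + hi) div 2" q] assms(3) that by simp
  then show ?thesis using assms(1,2) by (auto simp: bisect_inv_def)
qed

lemma bisect_inv_raise:
  assumes "bisect_inv N \<phi> (Suc v) lo hi" "lo < hi" "\<not> \<phi> ((lo + hi) div 2)" "mono_on {..<N} \<phi>"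
  shows "bisect_inv N \<phi> v (Suc ((lo + hi) div 2)) hi"
proof -
  have "(lo + hi) div 2 < N"
    using assms(1,2) unfolding bisect_inv_def by linarith
  then have "\<not> \<phi> q" if "q \<le> (lo + hi) div 2" for q
    using mono_onD[OF assms(4), of q "(lo + hi) div 2"] assms(3) that by auto
  then show ?thesis using assms(1,2) by (auto simp: bisect_inv_def less_Suc_eq_le)
qed

lemma hoare_bisect_step:
  assumes test: "E \<turnstile> \<lbrace>\<lambda>\<sigma>. r \<sigma> \<and> ivar \<sigma> ''pivot'' < N\<rbrace> P
      \<lbrace>\<lambda>\<sigma>. r \<sigma> \<and> (bval b \<sigma> \<longleftrightarrow> \<phi> (ivar \<sigma> ''pivot''))\<rbrace>"
    and mono: "mono_on {..<N} \<phi>"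
    and unaffected: "unaffected {''first'', ''last'', ''pivot''} r"
    and writes: "writes P \<inter> {''first'', ''last'', ''pivot''} = {}" and "0 < E"
  shows "E \<turnstile> \<lbrace>\<lambda>\<sigma>. r \<sigma> \<and> bisect_inv N \<phi> (Suc v) (ivar \<sigma> ''first'') (ivar \<sigma> ''last'') \<and>
      ivar \<sigma> ''first'' < ivar \<sigma> ''last''\<rbrace> bisect_step_com P b
    \<lbrace>\<lambda>\<sigma>. r \<sigma> \<and> bisect_inv N \<phi> v (ivar \<sigma> ''first'') (ivar \<sigma> ''last'')\<rbrace>"
proof -
  let ?lo = "\<lambda>\<sigma>. ivar \<sigma> ''first''" and ?hi = "\<lambda>\<sigma>. ivar \<sigma> ''last''" and ?mid = "\<lambda>\<sigma>. ivar \<sigma> ''pivot''"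
  define Halved where "Halved \<sigma> \<longleftrightarrow> bisect_inv N \<phi> (Suc v) (?lo \<sigma>) (?hi \<sigma>) \<and> ?lo \<sigma> < ?hi \<sigma> \<and>
    ?mid \<sigma> = (?lo \<sigma> + ?hi \<sigma>) div 2" for \<sigma> :: state
  have r_update: "r (\<sigma>\<lparr>ivar := (ivar \<sigma>)(x := k)\<rparr>)"
    if "r \<sigma>" "x \<in> {''first'', ''last'', ''pivot''}" for \<sigma> x k
    using unaffectedD[OF unaffected, of _ "{x}"] that by (auto simp: agree_except_def)
  have "E \<turnstile> \<lbrace>\<lambda>\<sigma>. r \<sigma> \<and> bisect_inv N \<phi> (Suc v) (?lo \<sigma>) (?hi \<sigma>) \<and> ?lo \<sigma> < ?hi \<sigma>\<rbrace>
      ISet ''pivot'' (IHalf (IAdd (IVar ''first'') (IVar ''last'')))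
    \<lbrace>\<lambda>\<sigma>. (r \<sigma> \<and> ?mid \<sigma> < N) \<and> Halved \<sigma>\<rbrace>"
    using \<open>0 < E\<close> r_update by (intro hoareI runs_ISet) (auto simp: Halved_def bisect_inv_def)
  also have "E \<turnstile> \<lbrace>\<dots>\<rbrace> P \<lbrace>\<lambda>\<sigma>. (r \<sigma> \<and> (bval b \<sigma> \<longleftrightarrow> \<phi> (?mid \<sigma>))) \<and> Halved \<sigma>\<rbrace>"
    using writes by (intro hoare_frame test) (auto simp: unaffected_def agree_except_def Halved_def)
  also have "E \<turnstile> \<lbrace>\<dots>\<rbrace>
      Cond b (ISet ''last'' (IVar ''pivot'')) (ISet ''first'' (IAdd (IVar ''pivot'') (INum 1)))
      \<lbrace>\<lambda>\<sigma>. r \<sigma> \<and> bisect_inv N \<phi> v (?lo \<sigma>) (?hi \<sigma>)\<rbrace>"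
    using \<open>0 < E\<close> r_update
    by (intro hoareI runs_Cond runs_ISet)
       (auto simp: Halved_def intro: bisect_inv_lower bisect_inv_raise mono)
  finally show ?thesis by (simp add: bisect_step_com_def)
qed

lemma hoare_bisect:
  assumes "E \<turnstile> \<lbrace>\<lambda>\<sigma>. r \<sigma> \<and> ivar \<sigma> ''pivot'' < N\<rbrace> P
      \<lbrace>\<lambda>\<sigma>. r \<sigma> \<and> (bval b \<sigma> \<longleftrightarrow> \<phi> (ivar \<sigma> ''pivot''))\<rbrace>"
    and "mono_on {..<N} \<phi>"
    and unaffected: "unaffected {''first'', ''last'', ''pivot''} r"
    and "writes P \<inter> {''first'', ''last'', ''pivot''} = {}"
    and n: "\<And>\<sigma>. r \<sigma> \<Longrightarrow> ivar \<sigma> n = N" and "N < 2 ^ L" "0 < E" "0 < L"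
  shows "E * L \<turnstile> \<lbrace>r\<rbrace> bisect_com n P b
    \<lbrace>\<lambda>\<sigma>. r \<sigma> \<and> ivar \<sigma> ''first'' \<le> N \<and> (\<forall>q<N. \<phi> q \<longleftrightarrow> ivar \<sigma> ''first'' \<le> q)\<rbrace>"
proof -
  define Inv where "Inv v \<sigma> \<longleftrightarrow> r \<sigma> \<and> bisect_inv N \<phi> v (ivar \<sigma> ''first'') (ivar \<sigma> ''last'')" for v \<sigma>
  have r_update: "r (\<sigma>\<lparr>ivar := (ivar \<sigma>)(x := k)\<rparr>)" if "r \<sigma>" "x \<in> {''first'', ''last''}" for \<sigma> x k
    using unaffectedD[OF unaffected, of _ "{x}"] that by (auto simp: agree_except_def)
  have "E * L \<turnstile> \<lbrace>r\<rbrace> ISet ''first'' (INum 0) \<lbrace>\<lambda>\<sigma>. r \<sigma> \<and> ivar \<sigma> ''first'' = 0\<rbrace>"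
    using \<open>0 < E\<close> \<open>0 < L\<close> r_update by (intro hoareI runs_ISet) simp_all
  also have "E * L \<turnstile> \<lbrace>\<dots>\<rbrace> ISet ''last'' (IVar n) \<lbrace>Inv L\<rbrace>"
    using \<open>0 < E\<close> \<open>0 < L\<close> \<open>N < 2 ^ L\<close> r_update n
    by (intro hoareI runs_ISet) (simp_all add: Inv_def bisect_inv_def)
  also have "E * L \<turnstile> \<lbrace>\<dots>\<rbrace> While (ILess (IVar ''first'') (IVar ''last'')) (bisect_step_com P b)
     \<lbrace>\<lambda>\<sigma>. \<not> bval (ILess (IVar ''first'') (IVar ''last'')) \<sigma> \<and> (\<exists>v. Inv v \<sigma>)\<rbrace>"
    using hoare_bisect_step[OF assms(1-4)] \<open>0 < E\<close> \<open>0 < L\<close>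
    by (intro hoare_While) (simp_all add: Inv_def bisect_inv_def)
  finally show ?thesis
    unfolding bisect_com_def by (rule hoare_conseq) (auto simp: Inv_def bisect_inv_def intro: leI)
qed

section \<open>Merge sort\<close>

lemma sorted_default_iff: "sorted default xs \<longleftrightarrow> sorted_wrt (\<le>) xs"
  by (induction xs rule: induct_list012) (auto simp: not_less intro: order_trans)

lemma sort_default_eqI:
  assumes "mset xs = mset ys" "sorted default ys"
  shows "sort default xs = ys"
proof (rule sort_eqI[OF assms])
  fix x
  have "count_list xs x = count_list ys x" using assms(1) by (rule mset_eq_length_filter)
  then have "filter ((=) x) xs = filter ((=) x) ys"
    by (metis count_list_eq_length_filter replicate_length_filter)
  then show "stable_segment default x xs = stable_segment default x ys" by simp
qed

lemma length_merge: "length (Sorting_Algorithms.merge cmp xs ys) = length xs + length ys"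
  by (metis mset_merge size_mset size_union)

abbreviation merge :: "'a::linorder list \<Rightarrow> 'a list \<Rightarrow> 'a list" where
  "merge \<equiv> Sorting_Algorithms.merge default"

function merge_pass :: "nat \<Rightarrow> 'a::linorder list \<Rightarrow> 'a list" where
  "merge_pass W xs = (if W = 0 \<or> xs = [] then xs else
     merge (take W xs) (take W (drop W xs)) @ merge_pass W (drop (2 * W) xs))"
  by pat_completeness auto
termination by (relation "measure (length \<circ> snd)") auto

declare merge_pass.simps [simp del]

lemma merge_pass_Nil [simp]: "merge_pass W [] = []"
  by (simp add: merge_pass.simps)

lemma mset_merge_pass [simp]: "mset (merge_pass W xs) = mset xs"
proof (induction W xs rule: merge_pass.induct)
  case (1 W xs)
  have "mset xs = mset (take W xs) + mset (take W (drop W xs)) + mset (drop (2 * W) xs)"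
    by (metis append_take_drop_id drop_drop mset_append mult_2 add.assoc)
  with 1 show ?case
    by (subst merge_pass.simps) (simp add: mset_merge)
qed

lemma length_merge_pass [simp]: "length (merge_pass W xs) = length xs"
  by (metis mset_merge_pass size_mset)

lemma take_drop_merge_pass:
  assumes "0 < W"
  shows "take (2 * W) (drop (p * (2 * W)) (merge_pass W xs)) = merge
    (take W (drop (2 * p * W) xs)) (take W (drop ((2 * p + 1) * W) xs))"
proof (induction p arbitrary: xs)
  case 0
  show ?case
    using assms by (cases "length xs < 2 * W") (auto simp: merge_pass.simps[of W xs] length_merge)
next
  case (Suc p)
  show ?case
    using assms Suc[of "drop (2 * W) xs"]
    by (cases "length xs < 2 * W") (auto simp: merge_pass.simps[of W xs] length_merge algebra_simps)
qed

definition sorted_blocks :: "nat \<Rightarrow> 'a::linorder list \<Rightarrow> bool" where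
  "sorted_blocks W xs \<longleftrightarrow> (\<forall>p. sorted default (take W (drop (p * W) xs)))"

lemma sorted_blocks_1: "sorted_blocks 1 xs"
  unfolding sorted_blocks_def
proof
  fix p show "sorted default (take 1 (drop (p * 1) xs))" by (cases "drop (p * 1) xs") simp_all
qed

lemma sorted_blocks_merge_pass:
  "0 < W \<Longrightarrow> sorted_blocks W xs \<Longrightarrow> sorted_blocks (2 * W) (merge_pass W xs)"
  unfolding sorted_blocks_def by (metis take_drop_merge_pass sorted_merge)

lemma sorted_if_sorted_blocks: "sorted_blocks W xs \<Longrightarrow> length xs \<le> W \<Longrightarrow> sorted default xs"
  unfolding sorted_blocks_def by (drule spec[of _ 0]) simp

lemma merge_map_upt_left:
  assumes "l < mid" "\<not> (r < nxt \<and> b r < b l)"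
  shows "merge (map b [l..<mid]) (map b [r..<nxt]) =
    b l # merge (map b [Suc l..<mid]) (map b [r..<nxt])"
  using assms by (cases "r < nxt") (auto simp: upt_conv_Cons)

lemma merge_map_upt_right:
  assumes "r < nxt" "l < mid \<Longrightarrow> b r < b l"
  shows "merge (map b [l..<mid]) (map b [r..<nxt]) =
    b r # merge (map b [l..<mid]) (map b [Suc r..<nxt])"
  using assms by (cases "l < mid") (auto simp: upt_conv_Cons)

lemma take_drop_conv_map_nth: "take k (drop l xs) = map ((!) xs) [l..<min (l + k) (length xs)]"
  by (rule nth_equalityI) auto

lemma merge_pass_drop:
  fixes xs :: "'a::linorder list"
  assumes "0 < W" "l < length xs" "mid = min (l + W) (length xs)" "nxt = min (mid + W) (length xs)"
  shows "merge_pass W (drop l xs) =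
    merge (map ((!) xs) [l..<mid]) (map ((!) xs) [mid..<nxt]) @
    merge_pass W (drop nxt xs)"
proof -
  have drop_mid: "drop W (drop l xs) = drop mid xs"
    and drop_nxt: "drop (2 * W) (drop l xs) = drop nxt xs"
    using assms(3,4) by (auto simp: min_def mult_2_right ac_simps)
  show ?thesis
    using assms
    by (subst merge_pass.simps) (simp only: drop_mid drop_nxt take_drop_conv_map_nth, simp)
qed

definition imin :: "iexp \<Rightarrow> iexp \<Rightarrow> iexp" where
  "imin e f = ISub e (ISub e f)"

lemma ival_imin [simp]: "ival (imin e f) \<sigma> = min (ival e \<sigma>) (ival f \<sigma>)"
  by (simp add: imin_def)

definition refill_com :: "string \<Rightarrow> com" where
  "refill_com n =
     Cond (BAnd (BNot (ILess (IVar ''left'') (IVar ''mid'')))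
         (BNot (ILess (IVar ''right'') (IVar ''next''))))
       (ISet ''left'' (IVar ''next'') ;;
        ISet ''mid'' (imin (IAdd (IVar ''left'') (IVar ''width'')) (IVar n)) ;;
        ISet ''right'' (IVar ''mid'') ;;
        ISet ''next'' (imin (IAdd (IVar ''mid'') (IVar ''width'')) (IVar n)))
       Skip"

definition emit_com :: com where
  "emit_com =
     Cond (BAnd (ILess (IVar ''left'') (IVar ''mid''))
         (BNot (BAnd (ILess (IVar ''right'') (IVar ''next''))
           (RLess (RArr ''sorted'' (IVar ''right'')) (RArr ''sorted'' (IVar ''left''))))))
       (RStore ''merged'' (IVar ''i'') (RArr ''sorted'' (IVar ''left'')) ;;
        ISet ''left'' (IAdd (IVar ''left'') (INum 1)))
       (RStore ''merged'' (IVar ''i'') (RArr ''sorted'' (IVar ''right'')) ;;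
        ISet ''right'' (IAdd (IVar ''right'') (INum 1)))"

definition merge_pass_com :: "string \<Rightarrow> com" where
  "merge_pass_com n =
     ISet ''mid'' (INum 0) ;; ISet ''next'' (INum 0) ;; For ''i'' n (refill_com n ;; emit_com)"

definition double_blocks_com :: "string \<Rightarrow> com" where
  "double_blocks_com n =
     merge_pass_com n ;;
     copy_com ''merged'' ''sorted'' n ;;
     ISet ''width'' (IAdd (IVar ''width'') (IVar ''width''))"

definition sort_com :: "string \<Rightarrow> string \<Rightarrow> com" where
  "sort_com a n =
     copy_com a ''sorted'' n ;;
     ISet ''width'' (INum 1) ;;
     While (ILess (IVar ''width'') (IVar n)) (double_blocks_com n)"

lemma writes_refill_com [simp]: "writes (refill_com n) = {''left'', ''mid'', ''right'', ''next''}"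
  by (auto simp: refill_com_def)

lemma writes_emit_com [simp]: "writes emit_com = {''left'', ''right'', ''merged''}"
  by (auto simp: emit_com_def)

lemma writes_merge_pass_com [simp]:
  "writes (merge_pass_com n) = {''i'', ''left'', ''mid'', ''right'', ''next'', ''merged''}"
  by (auto simp: merge_pass_com_def)

lemma writes_double_blocks_com [simp]: "writes (double_blocks_com n) =
    {''i'', ''left'', ''mid'', ''right'', ''next'', ''merged'', ''sorted'', ''width''}"
  by (auto simp: double_blocks_com_def)

lemma writes_sort_com [simp]: "writes (sort_com a n) =
    {''i'', ''left'', ''mid'', ''right'', ''next'', ''merged'', ''sorted'', ''width''}"
  by (auto simp: sort_com_def)

text \<open>The first \<open>i\<close> entries of the next pass have been written; the last of them were taken from the
  two blocks whose remainders lie at \<open>{left..<mid}\<close> and \<open>{right..<next}\<close>.\<close>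

definition merging :: "real list \<Rightarrow> nat \<Rightarrow> nat \<Rightarrow> state \<Rightarrow> bool" where
  "merging xs W i \<sigma> \<longleftrightarrow> ivar \<sigma> ''mid'' \<le> length xs \<and> ivar \<sigma> ''next'' \<le> length xs \<and>
     map (rarr \<sigma> ''merged'') [0..<i] @
       merge (map ((!) xs) [ivar \<sigma> ''left''..<ivar \<sigma> ''mid''])
         (map ((!) xs) [ivar \<sigma> ''right''..<ivar \<sigma> ''next'']) @
       merge_pass W (drop (ivar \<sigma> ''next'') xs) = merge_pass W xs"

definition pending :: "state \<Rightarrow> bool" where
  "pending \<sigma> \<longleftrightarrow> ivar \<sigma> ''left'' < ivar \<sigma> ''mid'' \<or> ivar \<sigma> ''right'' < ivar \<sigma> ''next''"

lemma hoare_refill: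
  assumes "i < length xs" "0 < W" "n \<notin> writes (refill_com n)"
  shows "1 \<turnstile> \<lbrace>\<lambda>\<sigma>. merging xs W i \<sigma> \<and> ivar \<sigma> ''width'' = W \<and> ivar \<sigma> n = length xs\<rbrace> refill_com n
    \<lbrace>\<lambda>\<sigma>. merging xs W i \<sigma> \<and> pending \<sigma>\<rbrace>"
proof (rule hoareI, elim conjE)
  fix \<sigma> assume merging: "merging xs W i \<sigma>" and "ivar \<sigma> ''width'' = W" "ivar \<sigma> n = length xs"
  have "ivar \<sigma> ''next'' < length xs" if "\<not> pending \<sigma>"
  proof -
    have "i + (length xs - ivar \<sigma> ''next'') = length xs"
      using arg_cong[OF conjunct2[OF conjunct2[OF merging[unfolded merging_def]]], of length] that
      by (simp add: length_merge pending_def)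
    then show ?thesis using \<open>i < length xs\<close> by simp
  qed
  with assms merging \<open>ivar \<sigma> ''width'' = W\<close> \<open>ivar \<sigma> n = length xs\<close>
  show "runs 1 (refill_com n) \<sigma> (\<lambda>\<sigma>. merging xs W i \<sigma> \<and> pending \<sigma>)"
    unfolding refill_com_def
    by (intro runs_intros)
       (auto simp: merging_def pending_def merge_pass_drop[OF _ _ refl refl] not_less)
qed

lemma hoare_emit:
  "1 \<turnstile> \<lbrace>\<lambda>\<sigma>. (merging xs W i \<sigma> \<and> pending \<sigma>) \<and>
      ivar \<sigma> ''i'' = i \<and> array_holds (rarr \<sigma> ''sorted'') xs\<rbrace> emit_com \<lbrace>merging xs W (Suc i)\<rbrace>"
  unfolding emit_com_def
  by (intro hoareI runs_intros)
     (auto simp: merging_def pending_def array_holds_def merge_map_upt_left merge_map_upt_right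
       simp del: upt_conv_Nil)

lemma hoare_merge_pass:
  assumes "0 < W" "length xs \<le> E" "0 < E" "n \<notin> writes (merge_pass_com n)"
  shows "E \<turnstile> \<lbrace>\<lambda>\<sigma>. ivar \<sigma> ''width'' = W \<and> ivar \<sigma> n = length xs \<and> array_holds (rarr \<sigma> ''sorted'') xs\<rbrace>
    merge_pass_com n \<lbrace>\<lambda>\<sigma>. array_holds (rarr \<sigma> ''merged'') (merge_pass W xs)\<rbrace>"
    (is "_ \<turnstile> \<lbrace>?r\<rbrace> _ \<lbrace>_\<rbrace>")
proof -
  have "E \<turnstile> \<lbrace>?r\<rbrace> ISet ''mid'' (INum 0) ;; ISet ''next'' (INum 0) \<lbrace>\<lambda>\<sigma>. ?r \<sigma> \<and> merging xs W 0 \<sigma>\<rbrace>"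
    using assms by (intro hoareI runs_intros) (auto simp: merging_def)
  also have "E \<turnstile> \<lbrace>\<dots>\<rbrace> For ''i'' n (refill_com n ;; emit_com) \<lbrace>\<lambda>\<sigma>. ?r \<sigma> \<and> merging xs W (length xs) \<sigma>\<rbrace>"
  proof (rule hoare_For)
    fix j \<sigma> assume j: "j < length xs" "ivar \<sigma> ''i'' = j" and "?r \<sigma>" "merging xs W j \<sigma>"
    have "1 \<turnstile> \<lbrace>\<lambda>\<sigma>. (merging xs W j \<sigma> \<and> ivar \<sigma> ''width'' = W \<and> ivar \<sigma> n = length xs) \<and>
        ivar \<sigma> ''i'' = j \<and> array_holds (rarr \<sigma> ''sorted'') xs\<rbrace> refill_com n ;; emit_com
      \<lbrace>merging xs W (Suc j)\<rbrace>"
      using assms j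
      by (intro hoare_Seq[OF hoare_frame[OF hoare_refill] hoare_emit])
         (auto simp: unaffected_def agree_except_def)
    then show "runs 1 (refill_com n ;; emit_com) \<sigma> (merging xs W (Suc j))"
      using j \<open>?r \<sigma>\<close> \<open>merging xs W j \<sigma>\<close> by (auto elim: hoareD)
  qed (use assms in \<open>auto simp: merging_def unaffected_def agree_except_def\<close>)
  finally show ?thesis
    unfolding merge_pass_com_def
  proof (rule hoare_conseq)
    fix \<sigma> assume "?r \<sigma> \<and> merging xs W (length xs) \<sigma>"
    then obtain rest
      where written: "map (rarr \<sigma> ''merged'') [0..<length xs] @ rest = merge_pass W xs"
      unfolding merging_def by blast
    have "rest = []" using arg_cong[OF written, of length] by simp
    with written show "array_holds (rarr \<sigma> ''merged'') (merge_pass W xs)"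
      by (simp add: array_holds_map_upt)
  qed simp_all
qed

lemma hoare_double_blocks:
  assumes "0 < W" "length xs \<le> E" "0 < E" "n \<notin> writes (double_blocks_com n)"
  shows "E \<turnstile> \<lbrace>\<lambda>\<sigma>. ivar \<sigma> ''width'' = W \<and> ivar \<sigma> n = length xs \<and> array_holds (rarr \<sigma> ''sorted'') xs\<rbrace>
    double_blocks_com n
    \<lbrace>\<lambda>\<sigma>. ivar \<sigma> ''width'' = 2 * W \<and> ivar \<sigma> n = length xs \<and>
      array_holds (rarr \<sigma> ''sorted'') (merge_pass W xs)\<rbrace>"
    (is "_ \<turnstile> \<lbrace>?pre\<rbrace> _ \<lbrace>?post\<rbrace>")
proof -
  let ?merged = "\<lambda>\<sigma>. (ivar \<sigma> ''width'' = W \<and> ivar \<sigma> n = length xs) \<and>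
    array_holds (rarr \<sigma> ''merged'') (merge_pass W xs)"
  have "E \<turnstile> \<lbrace>?pre\<rbrace> merge_pass_com n \<lbrace>?merged\<rbrace>"
    using assms
    by (intro hoare_conseq[OF hoare_merge_pass order_refl]) (auto simp: agree_except_def)
  also have "E \<turnstile> \<lbrace>\<dots>\<rbrace> copy_com ''merged'' ''sorted'' n
      \<lbrace>\<lambda>\<sigma>. ?merged \<sigma> \<and> array_holds (rarr \<sigma> ''sorted'') (merge_pass W xs)\<rbrace>"
    using assms by (intro hoare_copy) (auto simp: unaffected_def agree_except_def)
  also have "E \<turnstile> \<lbrace>\<dots>\<rbrace> ISet ''width'' (IAdd (IVar ''width'') (IVar ''width'')) \<lbrace>?post\<rbrace>"
    using assms by (intro hoareI runs_ISet) auto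
  finally show ?thesis by (simp add: double_blocks_com_def)
qed

definition permuted_into_blocks :: "real list \<Rightarrow> nat \<Rightarrow> state \<Rightarrow> bool" where
  "permuted_into_blocks xs W \<sigma> \<longleftrightarrow> ivar \<sigma> ''width'' = W \<and>
     (\<exists>ys. mset ys = mset xs \<and> sorted_blocks W ys \<and> array_holds (rarr \<sigma> ''sorted'') ys)"

lemma hoare_double_permuted_blocks:
  assumes "0 < W" "length xs \<le> E" "0 < E" "n \<notin> writes (double_blocks_com n)"
  shows "E \<turnstile> \<lbrace>\<lambda>\<sigma>. ivar \<sigma> n = length xs \<and> permuted_into_blocks xs W \<sigma>\<rbrace> double_blocks_com n
    \<lbrace>\<lambda>\<sigma>. ivar \<sigma> n = length xs \<and> permuted_into_blocks xs (2 * W) \<sigma>\<rbrace>"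
proof (rule hoareI, elim conjE)
  fix \<sigma> assume "ivar \<sigma> n = length xs" "permuted_into_blocks xs W \<sigma>"
  then obtain ys where ys: "mset ys = mset xs" "sorted_blocks W ys"
    and pre: "ivar \<sigma> ''width'' = W \<and> ivar \<sigma> n = length ys \<and> array_holds (rarr \<sigma> ''sorted'') ys"
    unfolding permuted_into_blocks_def by (metis size_mset)
  have "length ys = length xs" using ys(1) by (metis size_mset)
  then have "runs E (double_blocks_com n) \<sigma> (\<lambda>\<sigma>. ivar \<sigma> ''width'' = 2 * W \<and>
      ivar \<sigma> n = length ys \<and> array_holds (rarr \<sigma> ''sorted'') (merge_pass W ys))"
    using assms by (intro hoareD[OF hoare_double_blocks pre]) auto
  then show "runs E (double_blocks_com n) \<sigma>
      (\<lambda>\<sigma>. ivar \<sigma> n = length xs \<and> permuted_into_blocks xs (2 * W) \<sigma>)"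
    using ys \<open>length ys = length xs\<close> sorted_blocks_merge_pass[OF \<open>0 < W\<close> ys(2)]
    by (elim runs_conseq) (auto simp: permuted_into_blocks_def intro!: exI[of _ "merge_pass W ys"])
qed

lemma hoare_sort:
  assumes "length xs \<le> E" "0 < E" "length xs \<le> 2 ^ L" "0 < L"
    and names: "n \<notin> writes (sort_com a n)" "a \<notin> writes (sort_com a n)"
  shows "E * L \<turnstile> \<lbrace>\<lambda>\<sigma>. ivar \<sigma> n = length xs \<and> array_holds (rarr \<sigma> a) xs\<rbrace> sort_com a n
    \<lbrace>\<lambda>\<sigma>. array_holds (rarr \<sigma> ''sorted'') (sort default xs)\<rbrace>"
    (is "_ \<turnstile> \<lbrace>?pre\<rbrace> _ \<lbrace>_\<rbrace>")
proof -
  have E: "0 < E * L" "length xs \<le> E * L" using assms(1,2,4) by (auto intro: le_trans)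
  let ?loop_test = "ILess (IVar ''width'') (IVar n)"
  define Inv where
    "Inv v \<sigma> \<longleftrightarrow> v \<le> L \<and> ivar \<sigma> n = length xs \<and> permuted_into_blocks xs (2 ^ (L - v)) \<sigma>" for v \<sigma>
  have "E * L \<turnstile> \<lbrace>?pre\<rbrace> copy_com a ''sorted'' n \<lbrace>\<lambda>\<sigma>. ?pre \<sigma> \<and> array_holds (rarr \<sigma> ''sorted'') xs\<rbrace>"
    using E names by (intro hoare_copy) (auto simp: unaffected_def agree_except_def)
  also have "E * L \<turnstile> \<lbrace>\<dots>\<rbrace> ISet ''width'' (INum 1) \<lbrace>Inv L\<rbrace>"
    using E names sorted_blocks_1[of xs]
    by (intro hoareI runs_ISet) (auto simp: Inv_def permuted_into_blocks_def)
  also have "E * L \<turnstile> \<lbrace>\<dots>\<rbrace> While ?loop_test (double_blocks_com n)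
    \<lbrace>\<lambda>\<sigma>. \<not> bval ?loop_test \<sigma> \<and> (\<exists>v. Inv v \<sigma>)\<rbrace>"
  proof (rule hoare_While)
    fix v
    note double = hoare_double_permuted_blocks[where W = "2 ^ (L - Suc v)"]
    show "E \<turnstile> \<lbrace>\<lambda>\<sigma>. Inv (Suc v) \<sigma> \<and> bval ?loop_test \<sigma>\<rbrace> double_blocks_com n \<lbrace>Inv v\<rbrace>"
      using assms
      by (intro hoare_conseq[OF double order_refl])
         (auto simp: Inv_def Suc_diff_Suc simp flip: power_Suc)
  qed (use assms in \<open>auto simp: Inv_def permuted_into_blocks_def\<close>)
  finally show ?thesis
    unfolding sort_com_def
  proof (rule hoare_conseq)
    fix \<sigma> assume "\<not> bval ?loop_test \<sigma> \<and> (\<exists>v. Inv v \<sigma>)"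
    then obtain W ys where "length xs \<le> W" "mset ys = mset xs" "sorted_blocks W ys"
      and ys: "array_holds (rarr \<sigma> ''sorted'') ys"
      by (auto simp: Inv_def permuted_into_blocks_def not_less)
    then have "sort default xs = ys"
      by (metis sort_default_eqI sorted_if_sorted_blocks size_mset)
    with ys show "array_holds (rarr \<sigma> ''sorted'') (sort default xs)" by simp
  qed simp_all
qed

section \<open>Computing prescores\<close>

definition input_names :: "string set" where
  "input_names = {''num_voters'', ''num_cands'', ''num_edges'', ''num_selected'', ''k'',
     ''strength'', ''edge_voter'', ''edge_cand'', ''weight'', ''selected'', ''supp''}"

lemma stores_rvar_update [simp]:
  "stores (\<sigma>\<lparr>rvar := f\<rparr>) I A w vs cs es sel \<longleftrightarrow> stores \<sigma> I A w vs cs es sel"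
  by (simp add: stores_def)

locale encoded_solution = solution I A w
  for I :: "('n, 'c) election" and A w +
  fixes vs :: "'n list" and cs :: "'c list" and es :: "('n \<times> 'c) list" and sel :: "'c list"
  assumes vs: "distinct vs" "set vs = voters I" and cs: "distinct cs" "set cs = cands I"
    and es: "distinct es" "set es = edges I" and sel: "distinct sel" "set sel = A"
begin

abbreviation input :: "state \<Rightarrow> bool" where
  "input \<sigma> \<equiv> stores \<sigma> I A w vs cs es sel"

lemma inputD:
  assumes "input \<sigma>"
  shows "ivar \<sigma> ''num_voters'' = length vs" "ivar \<sigma> ''num_cands'' = length cs"
    "ivar \<sigma> ''num_edges'' = length es" "ivar \<sigma> ''num_selected'' = length sel"
    "array_holds (rarr \<sigma> ''strength'') (map (strength I) vs)"
    "array_holds (rarr \<sigma> ''weight'') (map w es)"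
    "array_holds (rarr \<sigma> ''supp'') (map (supp I w) sel)"
    "array_indexes (iarr \<sigma> ''edge_voter'') vs (map fst es)"
    "array_indexes (iarr \<sigma> ''edge_cand'') cs (map snd es)"
    "array_indexes (iarr \<sigma> ''selected'') cs sel"
  using assms by (simp_all add: stores_def array_holds_def array_indexes_def)

lemma unaffected_input:
  assumes "X \<inter> input_names = {}"
  shows "unaffected X input"
  unfolding unaffected_def
proof (intro allI impI)
  fix \<sigma> \<sigma>' assume "input \<sigma>" and agree: "agree_except X \<sigma> \<sigma>'"
  have "x \<notin> X" if "x \<in> input_names" for x using assms that by blast
  then show "input \<sigma>'"
    using \<open>input \<sigma>\<close> agree_exceptD[OF agree] unfolding stores_def input_names_def by simp
qed

lemma unaffected_input_array:
  assumes "X \<inter> input_names = {}" "a \<notin> X"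
  shows "unaffected X (\<lambda>\<sigma>. input \<sigma> \<and> array_holds (rarr \<sigma> a) xs)"
  using assms
  by (intro unaffected_conj unaffected_input) (auto simp: unaffected_def agree_except_def)

lemma length_bounds:
  shows "length vs \<le> length es" "length cs \<le> length es" "length sel \<le> length es" "0 < length es"
proof -
  have "set vs \<subseteq> fst ` set es" "set cs \<subseteq> snd ` set es"
    using instance_I by (force simp: election_instance_def vs cs es)+
  then have "card (set vs) \<le> card (set es)" "card (set cs) \<le> card (set es)"
    by (meson List.finite_set surj_card_le)+
  then show "length vs \<le> length es" and cs_es: "length cs \<le> length es"
    using vs(1) cs(1) es(1) by (simp_all only: distinct_card)
  have "card (set sel) \<le> card (set cs)"
    using A_subset finite_cands cs sel by (intro card_mono) auto
  with cs_es show "length sel \<le> length es" using cs(1) sel(1) by (simp only: distinct_card)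
  have "cs \<noteq> []" using unselected_nonempty cs by auto
  with cs_es show "0 < length es" by (cases cs) auto
qed

lemma sum_list_voter_edges:
  fixes g :: "'n \<times> 'c \<Rightarrow> real"
  shows "(\<Sum>e\<leftarrow>filter (\<lambda>e. fst e = n) es. g e) = (\<Sum>c\<in>cands_of I n. g (n, c))"
proof -
  have "(\<Sum>e\<leftarrow>filter (\<lambda>e. fst e = n) es. g e) = sum g {e \<in> edges I. fst e = n}"
    using es by (simp add: sum_list_distinct_conv_sum_set)
  also have "\<dots> = (\<Sum>c\<in>cands_of I n. g (n, c))"
    by (rule sum.reindex_bij_witness[where i = "Pair n" and j = snd]) (auto simp: cands_of_def)
  finally show ?thesis .
qed

lemma sum_list_cand_edges:
  fixes g :: "'n \<times> 'c \<Rightarrow> real"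
  shows "(\<Sum>e\<leftarrow>filter (\<lambda>e. snd e = c) es. g e) = (\<Sum>n\<in>voters_of I c. g (n, c))"
proof -
  have "(\<Sum>e\<leftarrow>filter (\<lambda>e. snd e = c) es. g e) = sum g {e \<in> edges I. snd e = c}"
    using es by (simp add: sum_list_distinct_conv_sum_set)
  also have "\<dots> = (\<Sum>n\<in>voters_of I c. g (n, c))"
    by (rule sum.reindex_bij_witness[where i = "\<lambda>n. (n, c)" and j = fst]) (auto simp: voters_of_def)
  finally show ?thesis .
qed

lemma sum_list_sel:
  fixes g :: "'c \<Rightarrow> real"
  shows "(\<Sum>c'\<leftarrow>filter (\<lambda>c'. c' = c) sel. g c') = (if c \<in> A then g c else 0)"
proof -
  have "(\<Sum>c'\<leftarrow>filter (\<lambda>c'. c' = c) sel. g c') = sum g {c' \<in> A. c' = c}"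
    using sel by (simp add: sum_list_distinct_conv_sum_set)
  also have "{c' \<in> A. c' = c} = (if c \<in> A then {c} else {})" by auto
  finally show ?thesis by simp
qed

end

text \<open>Division by zero yields zero on the machine as in \<open>slack\<close>, so members of \<open>A\<close> with support zero
  need no special treatment.\<close>

definition scales_com :: com where
  "scales_com = For ''i'' ''num_selected''
     (Cond (RLess (RDiv (RVar ''t'') (RArr ''supp'' (IVar ''i''))) (RNum 1))
       (RStore ''scale'' (IVar ''i'') (RDiv (RVar ''t'') (RArr ''supp'' (IVar ''i''))))
       (RStore ''scale'' (IVar ''i'') (RNum 1)))"

definition factors_com :: com where
  "factors_com = scatter_add ''factor'' ''num_cands'' (RNum 0)
     ''num_selected'' ''selected'' (RArr ''scale'' (IVar ''i''))"

definition slacks_com :: com where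
  "slacks_com = scatter_add ''slack'' ''num_voters'' (RArr ''strength'' (IVar ''i''))
     ''num_edges'' ''edge_voter''
     (RSub (RNum 0)
       (RMul (RArr ''weight'' (IVar ''i'')) (RArr ''factor'' (IArr ''edge_cand'' (IVar ''i'')))))"

definition slack_sums_com :: com where
  "slack_sums_com = scatter_add ''prescore'' ''num_cands'' (RNum 0)
     ''num_edges'' ''edge_cand'' (RArr ''slack'' (IArr ''edge_voter'' (IVar ''i'')))"

definition prescores_com :: com where
  "prescores_com = scales_com ;; factors_com ;; slacks_com ;; slack_sums_com"

definition select_com :: "string \<Rightarrow> com" where
  "select_com a =
     scatter_add ''taken'' ''num_cands'' (RNum 0) ''num_selected'' ''selected'' (RNum 1) ;;
     argmax_com a"

definition threshold_com :: com where
  "threshold_com = prescores_com ;; select_com ''prescore''"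

lemma writes_prescores_com [simp]:
  "writes prescores_com = {''i'', ''scale'', ''factor'', ''slack'', ''prescore''}"
  by (auto simp: prescores_com_def scales_com_def factors_com_def slacks_com_def slack_sums_com_def)

lemma writes_select_com [simp]:
  "writes (select_com a) = {''i'', ''taken'', ''result_cand'', ''result_value''}"
  by (auto simp: select_com_def)

lemma writes_threshold_com [simp]:
  "writes threshold_com = {''i'', ''scale'', ''factor'', ''slack'', ''prescore'', ''taken'',
     ''result_cand'', ''result_value''}"
  by (auto simp: threshold_com_def)

context encoded_solution
begin

lemma hoare_scales:
  "length es \<turnstile> \<lbrace>\<lambda>\<sigma>. input \<sigma> \<and> rvar \<sigma> ''t'' = t\<rbrace> scales_com
    \<lbrace>\<lambda>\<sigma>. input \<sigma> \<and> array_holds (rarr \<sigma> ''scale'') (map (\<lambda>c. min 1 (t / supp I w c)) sel)\<rbrace>"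
proof -
  have "length es \<turnstile> \<lbrace>\<lambda>\<sigma>. input \<sigma> \<and> rvar \<sigma> ''t'' = t\<rbrace> scales_com
    \<lbrace>\<lambda>\<sigma>. (input \<sigma> \<and> rvar \<sigma> ''t'' = t) \<and>
      array_holds (rarr \<sigma> ''scale'') (map (\<lambda>c. min 1 (t / supp I w c)) sel)\<rbrace>"
    unfolding scales_com_def
  proof (rule hoare_tabulate)
    show "unaffected {''i'', ''scale''} (\<lambda>\<sigma>. input \<sigma> \<and> rvar \<sigma> ''t'' = t)"
      by (intro unaffected_conj unaffected_input)
         (simp_all add: input_names_def unaffected_def agree_except_def)
  next
    fix j \<sigma> assume "j < length sel" "ivar \<sigma> ''i'' = j" "input \<sigma> \<and> rvar \<sigma> ''t'' = t"
    then show "runs 1 (Cond (RLess (RDiv (RVar ''t'') (RArr ''supp'' (IVar ''i''))) (RNum 1))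
       (RStore ''scale'' (IVar ''i'') (RDiv (RVar ''t'') (RArr ''supp'' (IVar ''i''))))
       (RStore ''scale'' (IVar ''i'') (RNum 1))) \<sigma>
      (\<lambda>\<sigma>'. rarr \<sigma>' ''scale'' = (rarr \<sigma> ''scale'')(j := min 1 (t / supp I w (sel ! j))))"
      using inputD(7) by (intro runs_intros) (auto simp: array_holds_def min_def)
  qed (use inputD length_bounds in auto)
  then show ?thesis by (rule hoare_conseq) auto
qed

lemma hoare_factors:
  "length es \<turnstile> \<lbrace>\<lambda>\<sigma>. input \<sigma> \<and> array_holds (rarr \<sigma> ''scale'') (map \<phi> sel)\<rbrace> factors_com
    \<lbrace>\<lambda>\<sigma>. input \<sigma> \<and> array_holds (rarr \<sigma> ''factor'') (map (\<lambda>c. if c \<in> A then \<phi> c else 0) cs)\<rbrace>"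
    (is "_ \<turnstile> \<lbrace>?r\<rbrace> _ \<lbrace>_\<rbrace>")
proof -
  have "unaffected {''i'', ''factor''} ?r"
    by (rule unaffected_input_array) (simp_all add: input_names_def)
  then have "length es \<turnstile> \<lbrace>?r\<rbrace> factors_com \<lbrace>\<lambda>\<sigma>. ?r \<sigma> \<and> array_holds (rarr \<sigma> ''factor'')
      (map (\<lambda>c. 0 + (\<Sum>c'\<leftarrow>filter (\<lambda>c'. c' = c) sel. \<phi> c')) cs)\<rbrace>"
    unfolding factors_com_def using inputD length_bounds cs(1)
    by (intro hoare_scatter_add) (auto simp: array_holds_def)
  then show ?thesis by (rule hoare_conseq) (auto simp: sum_list_sel)
qed

lemma hoare_slacks:
  "length es \<turnstile> \<lbrace>\<lambda>\<sigma>. input \<sigma> \<and> array_holds (rarr \<sigma> ''factor'') (map \<phi> cs)\<rbrace> slacks_com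
    \<lbrace>\<lambda>\<sigma>. input \<sigma> \<and> array_holds (rarr \<sigma> ''slack'')
      (map (\<lambda>n. strength I n - (\<Sum>c\<in>cands_of I n. w (n, c) * \<phi> c)) vs)\<rbrace>"
    (is "_ \<turnstile> \<lbrace>?r\<rbrace> _ \<lbrace>_\<rbrace>")
proof -
  have "unaffected {''i'', ''slack''} ?r"
    by (rule unaffected_input_array) (simp_all add: input_names_def)
  then have "length es \<turnstile> \<lbrace>?r\<rbrace> slacks_com \<lbrace>\<lambda>\<sigma>. ?r \<sigma> \<and> array_holds (rarr \<sigma> ''slack'')
      (map (\<lambda>n. strength I n + (\<Sum>e\<leftarrow>filter (\<lambda>e. fst e = n) es. - (w e * \<phi> (snd e)))) vs)\<rbrace>"
    unfolding slacks_com_def using inputD length_bounds vs(1)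
    by (intro hoare_scatter_add) (auto simp: array_holds_def array_indexes_def)
  then show ?thesis by (rule hoare_conseq) (auto simp: sum_list_voter_edges sum_negf)
qed

lemma hoare_slack_sums:
  "length es \<turnstile> \<lbrace>\<lambda>\<sigma>. input \<sigma> \<and> array_holds (rarr \<sigma> ''slack'') (map \<psi> vs)\<rbrace> slack_sums_com
    \<lbrace>\<lambda>\<sigma>. input \<sigma> \<and> array_holds (rarr \<sigma> ''prescore'') (map (\<lambda>c. \<Sum>n\<in>voters_of I c. \<psi> n) cs)\<rbrace>"
    (is "_ \<turnstile> \<lbrace>?r\<rbrace> _ \<lbrace>_\<rbrace>")
proof -
  have "unaffected {''i'', ''prescore''} ?r"
    by (rule unaffected_input_array) (simp_all add: input_names_def)
  then have "length es \<turnstile> \<lbrace>?r\<rbrace> slack_sums_com \<lbrace>\<lambda>\<sigma>. ?r \<sigma> \<and> array_holds (rarr \<sigma> ''prescore'')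
      (map (\<lambda>c. 0 + (\<Sum>e\<leftarrow>filter (\<lambda>e. snd e = c) es. \<psi> (fst e))) cs)\<rbrace>"
    unfolding slack_sums_com_def using inputD length_bounds cs(1)
    by (intro hoare_scatter_add) (auto simp: array_holds_def array_indexes_def)
  then show ?thesis by (rule hoare_conseq) (auto simp: sum_list_cand_edges)
qed

lemma hoare_prescores:
  "length es \<turnstile> \<lbrace>input\<rbrace> prescores_com
    \<lbrace>\<lambda>\<sigma>. input \<sigma> \<and>
      array_holds (rarr \<sigma> ''prescore'') (map (\<lambda>c. prescore I A w c (rvar \<sigma> ''t'')) cs)\<rbrace>"
proof (rule hoare_fix_value[where f = "\<lambda>\<sigma>. rvar \<sigma> ''t''"])
  fix t
  let ?\<phi> = "\<lambda>c. min 1 (t / supp I w c)"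
  let ?slack = "\<lambda>n. strength I n - (\<Sum>c\<in>cands_of I n. w (n, c) * (if c \<in> A then ?\<phi> c else 0))"
  note hoare_scales
  also note hoare_factors
  also note hoare_slacks
  also note hoare_slack_sums
  finally have "length es \<turnstile> \<lbrace>\<lambda>\<sigma>. input \<sigma> \<and> rvar \<sigma> ''t'' = t\<rbrace> prescores_com
      \<lbrace>\<lambda>\<sigma>. input \<sigma> \<and> array_holds (rarr \<sigma> ''prescore'') (map (\<lambda>c. \<Sum>n\<in>voters_of I c. ?slack n) cs)\<rbrace>"
    unfolding prescores_com_def .
  moreover have "?slack n = slack I A w n t" for n
    unfolding slack_def using finite_cands_of
    by (intro arg_cong2[where f = minus] refl sum.mono_neutral_cong_right) auto
  ultimately show "length es \<turnstile> \<lbrace>\<lambda>\<sigma>. input \<sigma> \<and> rvar \<sigma> ''t'' = t\<rbrace> prescores_com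
    \<lbrace>\<lambda>\<sigma>. input \<sigma> \<and>
      array_holds (rarr \<sigma> ''prescore'') (map (\<lambda>c. prescore I A w c (rvar \<sigma> ''t'')) cs)\<rbrace>"
    by (elim hoare_conseq) (auto simp: prescore_def agree_except_def)
qed

lemma hoare_select:
  assumes "a \<notin> writes (select_com a)"
  shows "length es \<turnstile> \<lbrace>\<lambda>\<sigma>. input \<sigma> \<and> array_holds (rarr \<sigma> a) (map f cs)\<rbrace> select_com a
    \<lbrace>\<lambda>\<sigma>. returns_max \<sigma> cs f unselected\<rbrace>"
    (is "_ \<turnstile> \<lbrace>?r\<rbrace> _ \<lbrace>_\<rbrace>")
proof -
  have "unaffected {''i'', ''taken''} ?r"
    using assms by (intro unaffected_input_array) (simp_all add: input_names_def)
  then have "length es \<turnstile> \<lbrace>?r\<rbrace>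
      scatter_add ''taken'' ''num_cands'' (RNum 0) ''num_selected'' ''selected'' (RNum 1)
    \<lbrace>\<lambda>\<sigma>. ?r \<sigma> \<and> array_holds (rarr \<sigma> ''taken'')
      (map (\<lambda>c. 0 + (\<Sum>c'\<leftarrow>filter (\<lambda>c'. c' = c) sel. 1)) cs)\<rbrace>"
    using inputD length_bounds cs(1) by (intro hoare_scatter_add) auto
  also have "length es \<turnstile> \<lbrace>\<dots>\<rbrace> argmax_com a \<lbrace>\<lambda>\<sigma>. returns_max \<sigma> cs f (set cs - A)\<rbrace>"
    using assms length_bounds unselected_nonempty
    by (intro hoare_conseq[OF hoare_argmax[where cs = cs and A = A and f = f] order_refl])
       (auto simp: cs inputD sum_list_sel of_bool_def cong: if_cong)
  finally show ?thesis by (simp add: select_com_def cs)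
qed

lemma hoare_threshold:
  "length es \<turnstile> \<lbrace>input\<rbrace> threshold_com
    \<lbrace>\<lambda>\<sigma>. returns_max \<sigma> cs (\<lambda>c. prescore I A w c (rvar \<sigma> ''t'')) unselected\<rbrace>"
proof (rule hoare_fix_value[where f = "\<lambda>\<sigma>. rvar \<sigma> ''t''"])
  fix t
  have "length es \<turnstile> \<lbrace>\<lambda>\<sigma>. input \<sigma> \<and> rvar \<sigma> ''t'' = t\<rbrace> prescores_com
    \<lbrace>\<lambda>\<sigma>. input \<sigma> \<and> array_holds (rarr \<sigma> ''prescore'') (map (\<lambda>c. prescore I A w c t) cs)\<rbrace>"
    by (rule hoare_conseq[OF hoare_prescores]) (auto simp: agree_except_def)
  also note hoare_select
  finally show "length es \<turnstile> \<lbrace>\<lambda>\<sigma>. input \<sigma> \<and> rvar \<sigma> ''t'' = t\<rbrace> threshold_com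
    \<lbrace>\<lambda>\<sigma>. returns_max \<sigma> cs (\<lambda>c. prescore I A w c (rvar \<sigma> ''t'')) unselected\<rbrace>"
    by (auto simp: threshold_com_def agree_except_def elim!: hoare_conseq)
qed

end

section \<open>Computing the maximum score\<close>

definition search_com :: com where
  "search_com = bisect_com ''num_selected''
     (RSet ''t'' (RArr ''sorted'' (IVar ''pivot'')) ;; threshold_com)
     (RLess (RVar ''result_value'') (RVar ''t''))"

definition bracket_com :: com where
  "bracket_com =
     Cond (ILess (INum 0) (IVar ''first''))
       (RSet ''low'' (RArr ''sorted'' (ISub (IVar ''first'') (INum 1))))
       (RSet ''low'' (RNum 0)) ;;
     Cond (ILess (IVar ''first'') (IVar ''num_selected''))
       (RSet ''high'' (RArr ''sorted'' (IVar ''first'')))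
       (RSet ''high'' (RAdd (RVar ''low'') (RNum 1)))"

definition prescores_at_com :: "string \<Rightarrow> com" where
  "prescores_at_com x = RSet ''t'' (RVar x) ;; prescores_com"

definition secant_fixpoint_exp :: "rexp \<Rightarrow> rexp \<Rightarrow> rexp \<Rightarrow> rexp \<Rightarrow> rexp" where
  "secant_fixpoint_exp a fa b fb =
     RDiv (RAdd (RMul fa (RSub b a)) (RMul a (RSub fa fb))) (RAdd (RSub b a) (RSub fa fb))"

lemma rval_secant_fixpoint_exp:
  assumes "rval fa \<sigma> = f (rval a \<sigma>)" "rval fb \<sigma> = f (rval b \<sigma>)"
  shows "rval (secant_fixpoint_exp a fa b fb) \<sigma> = secant_fixpoint f (rval a \<sigma>) (rval b \<sigma>)"
  using assms by (simp add: secant_fixpoint_exp_def secant_fixpoint_def)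

definition secant_scores_com :: com where
  "secant_scores_com =
     prescores_at_com ''low'' ;;
     copy_com ''prescore'' ''low_prescore'' ''num_cands'' ;;
     prescores_at_com ''high'' ;;
     For ''i'' ''num_cands'' (RStore ''value'' (IVar ''i'') (secant_fixpoint_exp
       (RVar ''low'') (RArr ''low_prescore'' (IVar ''i''))
       (RVar ''high'') (RArr ''prescore'' (IVar ''i''))))"

definition solve_com :: com where
  "solve_com = secant_scores_com ;; select_com ''value''"

definition score_com :: com where
  "score_com = sort_com ''supp'' ''num_selected'' ;; search_com ;; bracket_com ;; solve_com"

lemma writes_prescores_at_com [simp]:
  "writes (prescores_at_com x) = {''t'', ''i'', ''scale'', ''factor'', ''slack'', ''prescore''}"
  by (auto simp: prescores_at_com_def)

context encoded_solution
begin

definition sorted_supps :: "real list" where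
  "sorted_supps = sort default (map (supp I w) sel)"

lemma length_sorted_supps [simp]: "length sorted_supps = length sel"
  and set_sorted_supps: "set sorted_supps = supp I w ` A"
  by (simp_all add: sorted_supps_def sel)

lemma sorted_supps_mono: "p \<le> q \<Longrightarrow> q < length sel \<Longrightarrow> sorted_supps ! p \<le> sorted_supps ! q"
  using sorted_sort[of default "map (supp I w) sel"]
  unfolding sorted_supps_def sorted_default_iff by (intro sorted_nth_mono) simp_all

abbreviation sorted_input :: "state \<Rightarrow> bool" where
  "sorted_input \<sigma> \<equiv> input \<sigma> \<and> array_holds (rarr \<sigma> ''sorted'') sorted_supps"

definition splits_sorted_supps :: "nat \<Rightarrow> bool" where
  "splits_sorted_supps f \<longleftrightarrow>
     f \<le> length sel \<and> (\<forall>q<length sel. max_score < sorted_supps ! q \<longleftrightarrow> f \<le> q)"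

lemma hoare_sort_supps:
  assumes "length sel \<le> 2 ^ L" "0 < L"
  shows "length es * L \<turnstile> \<lbrace>input\<rbrace> sort_com ''supp'' ''num_selected''
    \<lbrace>sorted_input\<rbrace>"
proof -
  have "length es * L \<turnstile> \<lbrace>\<lambda>\<sigma>. (ivar \<sigma> ''num_selected'' = length (map (supp I w) sel) \<and>
        array_holds (rarr \<sigma> ''supp'') (map (supp I w) sel)) \<and> input \<sigma>\<rbrace>
      sort_com ''supp'' ''num_selected''
    \<lbrace>\<lambda>\<sigma>. array_holds (rarr \<sigma> ''sorted'') sorted_supps \<and> input \<sigma>\<rbrace>"
    using assms length_bounds unfolding sorted_supps_def
    by (intro hoare_frame hoare_sort unaffected_input) (simp_all add: input_names_def)
  then show ?thesis by (rule hoare_conseq) (simp_all add: inputD)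
qed

lemma hoare_search_test:
  "length es \<turnstile> \<lbrace>\<lambda>\<sigma>. sorted_input \<sigma> \<and> ivar \<sigma> ''pivot'' < length sel\<rbrace>
    RSet ''t'' (RArr ''sorted'' (IVar ''pivot'')) ;; threshold_com
    \<lbrace>\<lambda>\<sigma>. sorted_input \<sigma> \<and> (bval (RLess (RVar ''result_value'') (RVar ''t'')) \<sigma> \<longleftrightarrow>
      max_score < sorted_supps ! ivar \<sigma> ''pivot'')\<rbrace>"
proof -
  let ?r = "\<lambda>\<sigma>. sorted_input \<sigma> \<and> rvar \<sigma> ''t'' = sorted_supps ! ivar \<sigma> ''pivot''"
  have "length es \<turnstile> \<lbrace>\<lambda>\<sigma>. sorted_input \<sigma> \<and> ivar \<sigma> ''pivot'' < length sel\<rbrace>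
    RSet ''t'' (RArr ''sorted'' (IVar ''pivot'')) \<lbrace>\<lambda>\<sigma>. input \<sigma> \<and> ?r \<sigma>\<rbrace>"
    using length_bounds by (intro hoareI runs_RSet) (auto simp: array_holds_def)
  also have "length es \<turnstile> \<lbrace>\<dots>\<rbrace> threshold_com
      \<lbrace>\<lambda>\<sigma>. returns_max \<sigma> cs (\<lambda>c. prescore I A w c (rvar \<sigma> ''t'')) unselected \<and> ?r \<sigma>\<rbrace>"
    by (intro hoare_frame hoare_threshold unaffected_conj[OF unaffected_input_array])
       (simp_all add: input_names_def unaffected_def agree_except_def)
  finally show ?thesis
    by (rule hoare_conseq) (auto simp: returns_max_def returns_def max_score_less_iff)
qed

lemma hoare_search:
  assumes "length sel < 2 ^ L" "0 < L"
  shows "length es * L \<turnstile> \<lbrace>sorted_input\<rbrace> search_com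
    \<lbrace>\<lambda>\<sigma>. sorted_input \<sigma> \<and> splits_sorted_supps (ivar \<sigma> ''first'')\<rbrace>"
  unfolding search_com_def splits_sorted_supps_def
proof (rule hoare_bisect[OF hoare_search_test])
  show "mono_on {..<length sel} (\<lambda>q. max_score < sorted_supps ! q)"
    using sorted_supps_mono by (intro mono_onI) (auto intro: less_le_trans)
qed (use assms length_bounds in \<open>auto simp: inputD input_names_def intro!: unaffected_input_array\<close>)

lemma brackets_sorted_supps:
  assumes "splits_sorted_supps f"
    and low: "low = (if 0 < f then sorted_supps ! (f - 1) else 0)"
    and high: "high = (if f < length sel then sorted_supps ! f else low + 1)"
  shows "brackets low high"
proof -
  have "f \<le> length sel"
    and f: "\<And>q. q < length sel \<Longrightarrow> max_score < sorted_supps ! q \<longleftrightarrow> f \<le> q"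
    using assms(1) by (auto simp: splits_sorted_supps_def)
  have "0 \<le> sorted_supps ! q" if "q < length sel" for q
    using that set_sorted_supps supp_nonneg nth_mem[of q sorted_supps] by auto
  then have "0 \<le> low" using low \<open>f \<le> length sel\<close> by auto
  moreover have "low \<le> max_score"
    using low f[of "f - 1"] \<open>f \<le> length sel\<close> max_score_nonneg by (auto simp: not_less[symmetric])
  moreover have "low < high" using calculation high f[of f] by auto
  moreover have "supp I w c \<le> low \<or> max high max_score \<le> supp I w c" if "c \<in> A" for c
  proof -
    have "supp I w c \<in> set sorted_supps" using that set_sorted_supps by blast
    then obtain q where q: "q < length sel" "supp I w c = sorted_supps ! q"
      by (auto simp: in_set_conv_nth)
    show ?thesis
    proof (cases "f \<le> q")
      case True
      then show ?thesis using q f[OF q(1)] high sorted_supps_mono[OF True q(1)] by auto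
    next
      case False
      then show ?thesis
        using q low sorted_supps_mono[of q "f - 1"] \<open>f \<le> length sel\<close> by auto
    qed
  qed
  ultimately show ?thesis by (simp add: brackets_def)
qed

lemma hoare_bracket:
  "length es \<turnstile> \<lbrace>\<lambda>\<sigma>. sorted_input \<sigma> \<and> splits_sorted_supps (ivar \<sigma> ''first'')\<rbrace> bracket_com
    \<lbrace>\<lambda>\<sigma>. input \<sigma> \<and> brackets (rvar \<sigma> ''low'') (rvar \<sigma> ''high'')\<rbrace>"
proof (rule hoareI, elim conjE)
  fix \<sigma> :: state
  let ?f = "ivar \<sigma> ''first''"
  let ?low = "if 0 < ?f then sorted_supps ! (?f - 1) else 0"
  let ?high = "if ?f < length sel then sorted_supps ! ?f else ?low + 1"
  assume input: "input \<sigma>" and supps: "array_holds (rarr \<sigma> ''sorted'') sorted_supps"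
    and splits: "splits_sorted_supps ?f"
  have "brackets ?low ?high" using splits by (rule brackets_sorted_supps) auto
  moreover have "?f \<le> length sel" using splits by (simp add: splits_sorted_supps_def)
  ultimately show "runs (length es) bracket_com \<sigma>
      (\<lambda>\<sigma>. input \<sigma> \<and> brackets (rvar \<sigma> ''low'') (rvar \<sigma> ''high''))"
    unfolding bracket_com_def using input supps length_bounds(4) inputD(4)[OF input]
    by (intro runs_intros) (simp_all add: array_holds_def)
qed

lemma hoare_prescores_at:
  "length es \<turnstile> \<lbrace>\<lambda>\<sigma>. input \<sigma> \<and> rvar \<sigma> x = u\<rbrace> prescores_at_com x
    \<lbrace>\<lambda>\<sigma>. input \<sigma> \<and> array_holds (rarr \<sigma> ''prescore'') (map (\<lambda>c. prescore I A w c u) cs)\<rbrace>"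
proof -
  have "length es \<turnstile> \<lbrace>\<lambda>\<sigma>. input \<sigma> \<and> rvar \<sigma> x = u\<rbrace> RSet ''t'' (RVar x)
      \<lbrace>\<lambda>\<sigma>. input \<sigma> \<and> rvar \<sigma> ''t'' = u\<rbrace>"
    using length_bounds by (intro hoareI runs_RSet) auto
  also have "length es \<turnstile> \<lbrace>\<dots>\<rbrace> prescores_com
    \<lbrace>\<lambda>\<sigma>. input \<sigma> \<and> array_holds (rarr \<sigma> ''prescore'') (map (\<lambda>c. prescore I A w c u) cs)\<rbrace>"
    by (rule hoare_conseq[OF hoare_prescores]) (auto simp: agree_except_def)
  finally show ?thesis by (simp add: prescores_at_com_def)
qed

lemma hoare_secant_scores:
  "length es \<turnstile> \<lbrace>\<lambda>\<sigma>. input \<sigma> \<and> rvar \<sigma> ''low'' = a \<and> rvar \<sigma> ''high'' = b\<rbrace> secant_scores_com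
    \<lbrace>\<lambda>\<sigma>. input \<sigma> \<and> array_holds (rarr \<sigma> ''value'') (map (secant_score a b) cs)\<rbrace>"
proof -
  let ?p = "\<lambda>x \<sigma>. input \<sigma> \<and> array_holds (rarr \<sigma> ''prescore'') (map (\<lambda>c. prescore I A w c x) cs)"
  let ?ab = "\<lambda>\<sigma>. rvar \<sigma> ''low'' = a \<and> rvar \<sigma> ''high'' = b"
  let ?low = "\<lambda>\<sigma>. array_holds (rarr \<sigma> ''low_prescore'') (map (\<lambda>c. prescore I A w c a) cs)"
  note unaffected = unaffected_conj[OF unaffected_input_array]
  have "length es \<turnstile> \<lbrace>\<lambda>\<sigma>. input \<sigma> \<and> ?ab \<sigma>\<rbrace> prescores_at_com ''low'' \<lbrace>\<lambda>\<sigma>. ?p a \<sigma> \<and> ?ab \<sigma>\<rbrace>"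
    by (rule hoare_conseq[OF hoare_prescores_at[where x = "''low''" and u = a]])
       (auto simp: agree_except_def)
  also have "length es \<turnstile> \<lbrace>\<dots>\<rbrace> copy_com ''prescore'' ''low_prescore'' ''num_cands''
    \<lbrace>\<lambda>\<sigma>. (?p a \<sigma> \<and> ?ab \<sigma>) \<and> ?low \<sigma>\<rbrace>"
    using length_bounds inputD(2)
    by (intro hoare_copy unaffected) (auto simp: input_names_def unaffected_def agree_except_def)
  also have "length es \<turnstile> \<lbrace>\<dots>\<rbrace> prescores_at_com ''high'' \<lbrace>\<lambda>\<sigma>. ?p b \<sigma> \<and> ?ab \<sigma> \<and> ?low \<sigma>\<rbrace>"
    by (rule hoare_conseq[OF hoare_prescores_at[where x = "''high''" and u = b]])
       (auto simp: agree_except_def)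
  also have "length es \<turnstile> \<lbrace>\<dots>\<rbrace> For ''i'' ''num_cands'' (RStore ''value'' (IVar ''i'')
      (secant_fixpoint_exp (RVar ''low'') (RArr ''low_prescore'' (IVar ''i''))
        (RVar ''high'') (RArr ''prescore'' (IVar ''i''))))
    \<lbrace>\<lambda>\<sigma>. (?p b \<sigma> \<and> ?ab \<sigma> \<and> ?low \<sigma>) \<and> array_holds (rarr \<sigma> ''value'') (map (secant_score a b) cs)\<rbrace>"
    using length_bounds inputD(2)
    by (intro hoare_tabulate runs_RStore unaffected)
       (auto simp: array_holds_def input_names_def unaffected_def agree_except_def
         rval_secant_fixpoint_exp secant_score_def)
  finally show ?thesis
    unfolding secant_scores_com_def by (rule hoare_conseq) auto
qed

lemma hoare_solve:
  "length es \<turnstile> \<lbrace>\<lambda>\<sigma>. input \<sigma> \<and> brackets (rvar \<sigma> ''low'') (rvar \<sigma> ''high'')\<rbrace> solve_com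
    \<lbrace>\<lambda>\<sigma>. returns_max \<sigma> cs (score I A w) unselected\<rbrace>"
proof (rule hoare_fix_value[where f = "\<lambda>\<sigma>. (rvar \<sigma> ''low'', rvar \<sigma> ''high'')"])
  fix ab :: "real \<times> real"
  obtain a b where ab: "ab = (a, b)" by (cases ab)
  note hoare_secant_scores
  also note hoare_select
  finally have "length es \<turnstile> \<lbrace>\<lambda>\<sigma>. input \<sigma> \<and> rvar \<sigma> ''low'' = a \<and> rvar \<sigma> ''high'' = b\<rbrace> solve_com
      \<lbrace>\<lambda>\<sigma>. returns_max \<sigma> cs (secant_score a b) unselected\<rbrace>"
    by (simp add: solve_com_def)
  then show "length es \<turnstile> \<lbrace>\<lambda>\<sigma>. (input \<sigma> \<and> brackets (rvar \<sigma> ''low'') (rvar \<sigma> ''high'')) \<and>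
      (rvar \<sigma> ''low'', rvar \<sigma> ''high'') = ab\<rbrace> solve_com
    \<lbrace>\<lambda>\<sigma>. returns_max \<sigma> cs (score I A w) unselected\<rbrace>"
  proof (rule hoare_conseq)
    fix \<sigma> \<sigma>' :: state
    assume "(input \<sigma> \<and> brackets (rvar \<sigma> ''low'') (rvar \<sigma> ''high'')) \<and>
      (rvar \<sigma> ''low'', rvar \<sigma> ''high'') = ab"
    then have "brackets a b" by (auto simp: ab)
    moreover assume "returns_max \<sigma>' cs (secant_score a b) unselected"
    ultimately show "returns_max \<sigma>' cs (score I A w) unselected"
      using secant_score_maximiser unfolding returns_max_def by metis
  qed (auto simp: ab)
qed

lemma hoare_score:
  assumes "length sel < 2 ^ L" "0 < L"
  shows "length es * L \<turnstile> \<lbrace>input\<rbrace> score_com \<lbrace>\<lambda>\<sigma>. returns_max \<sigma> cs (score I A w) unselected\<rbrace>"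
proof -
  have cost_le: "length es \<le> length es * L" using \<open>0 < L\<close> by simp
  note hoare_sort_supps[OF less_imp_le[OF assms(1)] assms(2)]
  also note hoare_search[OF assms]
  also note hoare_conseq[OF hoare_bracket cost_le]
  also note hoare_conseq[OF hoare_solve cost_le]
  finally show ?thesis unfolding score_com_def .
qed

lemma card_edges: "card (edges I) = length es"
  using es distinct_card by metis

lemma threshold_halts_within:
  assumes "input \<sigma>"
  shows "halts_within threshold_com \<sigma> (unit_cost threshold_com * card (edges I))
    (\<lambda>\<sigma>'. returns_max \<sigma>' cs (\<lambda>c. prescore I A w c (rvar \<sigma> ''t'')) unselected)"
proof (rule halts_within_hoare)
  show "length es \<turnstile> \<lbrace>\<lambda>\<sigma>'. input \<sigma>' \<and> rvar \<sigma>' ''t'' = rvar \<sigma> ''t''\<rbrace> threshold_com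
    \<lbrace>\<lambda>\<sigma>'. returns_max \<sigma>' cs (\<lambda>c. prescore I A w c (rvar \<sigma> ''t'')) unselected\<rbrace>"
    by (rule hoare_conseq[OF hoare_threshold]) (auto simp: agree_except_def)
qed (use assms in \<open>simp_all add: card_edges\<close>)

lemma score_halts_within:
  assumes "input \<sigma>"
  shows "halts_within score_com \<sigma>
    (2 * unit_cost score_com * (card (edges I) * max 1 (log 2 (seats I))))
    (\<lambda>\<sigma>'. returns_max \<sigma>' cs (score I A w) unselected)"
proof (rule halts_within_hoare[OF hoare_score assms])
  let ?L = "floorlog 2 (seats I)"
  have "0 < seats I" "length sel \<le> seats I"
    using instance_I solution_A sel(2) distinct_card[OF sel(1)]
    by (auto simp: election_instance_def partial_solution_def)
  then show "length sel < 2 ^ ?L" "0 < ?L"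
    using floorlog_bounds[of "seats I" 2] by (auto simp: floorlog_def)
  have "real ?L \<le> 2 * max 1 (log 2 (seats I))"
    using \<open>0 < seats I\<close> by (simp add: floorlog_def) linarith
  then have "real (unit_cost score_com * length es) * ?L
      \<le> real (unit_cost score_com * length es) * (2 * max 1 (log 2 (seats I)))"
    by (rule mult_left_mono) simp
  then show "real (unit_cost score_com * (length es * ?L))
      \<le> 2 * unit_cost score_com * (card (edges I) * max 1 (log 2 (seats I)))"
    by (simp add: card_edges ac_simps)
qed

end

theorem theorem6:
  "(\<exists>(P :: com) (K :: real).
      \<forall>(I :: ('n, 'c) election) A w t \<sigma> vs cs es sel.
        election_instance I \<longrightarrow> partial_solution I A w \<longrightarrow> 0 \<le> t \<longrightarrow>
        stores \<sigma> I A w vs cs es sel \<longrightarrow> rvar \<sigma> ''t'' = t \<longrightarrow>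
        halts_within P \<sigma> (K * real (card (edges I)))
          (\<lambda>\<sigma>'. \<exists>c p. returns \<sigma>' cs c p \<and> c \<in> cands I - A \<and>
             p = prescore I A w c t \<and>
             p = Max ((\<lambda>c'. prescore I A w c' t) ` (cands I - A))))
   \<and>
   (\<exists>(P :: com) (K :: real).
      \<forall>(I :: ('n, 'c) election) A w \<sigma> vs cs es sel.
        election_instance I \<longrightarrow> partial_solution I A w \<longrightarrow>
        stores \<sigma> I A w vs cs es sel \<longrightarrow>
        halts_within P \<sigma> (K * (real (card (edges I)) * max 1 (log 2 (real (seats I)))))
          (\<lambda>\<sigma>'. \<exists>c r. returns \<sigma>' cs c r \<and> c \<in> cands I - A \<and>
             r = score I A w c \<and>
             r = Max ((\<lambda>c'. score I A w c') ` (cands I - A))))"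
proof (intro conjI exI allI impI)
  fix I :: "('n, 'c) election" and A w t \<sigma> vs cs es sel
  assume assms: "election_instance I" "partial_solution I A w" "stores \<sigma> I A w vs cs es sel"
    and "rvar \<sigma> ''t'' = t"
  then interpret encoded_solution I A w vs cs es sel by unfold_locales (auto simp: stores_def)
  show "halts_within threshold_com \<sigma> (unit_cost threshold_com * real (card (edges I)))
    (\<lambda>\<sigma>'. \<exists>c p. returns \<sigma>' cs c p \<and> c \<in> cands I - A \<and> p = prescore I A w c t \<and>
       p = Max ((\<lambda>c'. prescore I A w c' t) ` (cands I - A)))"
    using threshold_halts_within[OF assms(3)] \<open>rvar \<sigma> ''t'' = t\<close>
    unfolding halts_within_def returns_max_def by simp blast
next
  fix I :: "('n, 'c) election" and A w \<sigma> vs cs es sel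
  assume assms: "election_instance I" "partial_solution I A w" "stores \<sigma> I A w vs cs es sel"
  then interpret encoded_solution I A w vs cs es sel by unfold_locales (auto simp: stores_def)
  show "halts_within score_com \<sigma>
    (2 * unit_cost score_com * (real (card (edges I)) * max 1 (log 2 (real (seats I)))))
    (\<lambda>\<sigma>'. \<exists>c r. returns \<sigma>' cs c r \<and> c \<in> cands I - A \<and> r = score I A w c \<and>
       r = Max ((\<lambda>c'. score I A w c') ` (cands I - A)))"
    using score_halts_within[OF assms(3)] unfolding halts_within_def returns_max_def by blast
qed

end
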